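(* Let $n\geq1$, let $F:[0,+\infty)\rightarrow\mathbb R$ be a continuous function bounded from below and let $\omega\subset\mathbb R^n$ be a measurable set which is not dense in $\mathbb R^n$. Assume that $\lim_{+\infty}F$ exists and is a non-negative real number (so that $F$ is bounded). Then, if $\alpha>\sup F$, the equation $(E_F)$ associated with $F$ and $\omega$ is not exponentially stabilizable from $\omega$ at rate $\alpha$.
   Context: $L^2(\mathbb R^n)$ is the space of complex-valued square-integrable functions, $\mathcal L(L^2(\mathbb R^n))$ the bounded linear operators on it, and $\mathbf 1_\omega$ the characteristic function of $\omega$, also viewed as a multiplication operator. For a continuous function $F:[0,+\infty)\to\mathbb R$ bounded from below, $F(|D_x|)$ is the Fourier multiplier with symbol $F(|\xi|)$, where $|\cdot|$ is the Euclidean norm, with domain $\{u\in L^2(\mathbb R^n): F(|D_x|)u\in L^2(\mathbb R^n)\}$. For $B\in\mathcal L(L^2(\mathbb R^n))$, $(e^{-t(F(|D_x|)+B)})_{t\geq0}$ denotes the strongly continuous semigroup generated by $-(F(|D_x|)+B)$ (it exists by bounded perturbation theory). The control system $(E_F)$ is $$\partial_tf(t,x)+F(|D_x|)f(t,x)=h(t,x)\mathbf 1_\omega(x),\quad t>0,\ x\in\mathbb R^n,\qquad f(0,\cdot)=f_0\in L^2(\mathbb R^n).$$ Exponential stabilizability at a given rate: $(E_F)$ is exponentially stabilizable from $\omega$ at rate $\alpha>0$ if there exist $M_\alpha\geq1$ and a feedback $K_\alpha\in\mathcal L(L^2(\mathbb R^n))$ such that $\Vert e^{-t(F(|D_x|)+\mathbf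 1_\omega K_\alpha)}\Vert_{\mathcal L(L^2(\mathbb R^n))}\le M_\alpha e^{-\alpha t}$ for all $t\geq0$. *)

theory Defs
  imports "HOL-Analysis.Analysis"
begin

section \<open>The complex Hilbert space of square-integrable functions\<close>

definition square_integrable :: "('a::euclidean_space \<Rightarrow> complex) \<Rightarrow> bool" where
  "square_integrable f \<longleftrightarrow>
     f \<in> borel_measurable lebesgue \<and> integrable lebesgue (\<lambda>x. (cmod (f x))\<^sup>2)"

definition L2_rel :: "('a::euclidean_space \<Rightarrow> complex) \<Rightarrow> ('a \<Rightarrow> complex) \<Rightarrow> bool" where
  "L2_rel f g \<longleftrightarrow>
     square_integrable f \<and> square_integrable g \<and> (AE x in lebesgue. f x = g x)"

lemma square_integrable_0: "square_integrable (\<lambda>_. 0)"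
  by (simp add: square_integrable_def)

lemma square_integrable_add:
  assumes "square_integrable f" "square_integrable g"
  shows "square_integrable (\<lambda>x. f x + g x)"
  unfolding square_integrable_def
proof
  show m: "(\<lambda>x. f x + g x) \<in> borel_measurable lebesgue"
    using assms by (auto simp: square_integrable_def)
  have "(cmod (f x + g x))\<^sup>2 \<le> 2 * (cmod (f x))\<^sup>2 + 2 * (cmod (g x))\<^sup>2" for x
  proof -
    have "(cmod (f x + g x))\<^sup>2 \<le> (cmod (f x) + cmod (g x))\<^sup>2"
      by (intro power_mono norm_triangle_ineq) auto
    also have "\<dots> \<le> 2 * (cmod (f x))\<^sup>2 + 2 * (cmod (g x))\<^sup>2"
      using sum_squares_bound[of "cmod (f x)" "cmod (g x)"] by (simp add: power2_sum)
    finally show ?thesis .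
  qed
  then have "AE x in lebesgue. norm ((cmod (f x + g x))\<^sup>2)
      \<le> norm (2 * (cmod (f x))\<^sup>2 + 2 * (cmod (g x))\<^sup>2)"
    by simp
  moreover have "integrable lebesgue (\<lambda>x. 2 * (cmod (f x))\<^sup>2 + 2 * (cmod (g x))\<^sup>2)"
    using assms by (simp add: square_integrable_def)
  moreover have "(\<lambda>x. (cmod (f x + g x))\<^sup>2) \<in> borel_measurable lebesgue"
    using m by measurable
  ultimately show "integrable lebesgue (\<lambda>x. (cmod (f x + g x))\<^sup>2)"
    by (rule Bochner_Integration.integrable_bound[rotated 2])
qed

lemma square_integrable_cmult:
  assumes "square_integrable f"
  shows "square_integrable (\<lambda>x. c * f x)"
  using assms by (auto simp: square_integrable_def norm_mult power_mult_distrib)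

lemma square_integrable_minus:
  "square_integrable f \<Longrightarrow> square_integrable (\<lambda>x. - f x)"
  using square_integrable_cmult[of f "-1"] by simp

lemma square_integrable_diff:
  "square_integrable f \<Longrightarrow> square_integrable g \<Longrightarrow> square_integrable (\<lambda>x. f x - g x)"
  using square_integrable_add[of f "\<lambda>x. - g x"] square_integrable_minus[of g] by simp

lemma integrable_mult_cnj:
  assumes "square_integrable f" "square_integrable g"
  shows "integrable lebesgue (\<lambda>x. f x * cnj (g x))"
proof (rule Bochner_Integration.integrable_bound
    [where f = "\<lambda>x. (cmod (f x))\<^sup>2 + (cmod (g x))\<^sup>2"])
  show "integrable lebesgue (\<lambda>x. (cmod (f x))\<^sup>2 + (cmod (g x))\<^sup>2)"
    using assms by (auto simp: square_integrable_def)
  have [measurable]: "f \<in> borel_measurable lebesgue" "g \<in> borel_measurable lebesgue"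
    using assms by (auto simp: square_integrable_def)
  have [measurable]: "(\<lambda>x. cnj (g x)) \<in> borel_measurable lebesgue"
    using borel_measurable_continuous_onI[OF continuous_on_cnj[OF continuous_on_id]]
      measurable_compose[OF \<open>g \<in> borel_measurable lebesgue\<close>] by blast
  show "(\<lambda>x. f x * cnj (g x)) \<in> borel_measurable lebesgue"
    by measurable
  have "cmod (f x) * cmod (g x) \<le> (cmod (f x))\<^sup>2 + (cmod (g x))\<^sup>2" for x
    using sum_squares_bound[of "cmod (f x)" "cmod (g x)"]
      mult_nonneg_nonneg[OF norm_ge_zero[of "f x"] norm_ge_zero[of "g x"]] by linarith
  then show "AE x in lebesgue. norm (f x * cnj (g x)) \<le> norm ((cmod (f x))\<^sup>2 + (cmod (g x))\<^sup>2)"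
    by (simp add: norm_mult)
qed

quotient_type (overloaded) 'a L2 =
  "'a::euclidean_space \<Rightarrow> complex" / partial: L2_rel
proof (rule part_equivpI)
  show "\<exists>f::'a \<Rightarrow> complex. L2_rel f f"
    by (rule exI[of _ "\<lambda>_. 0"]) (simp add: L2_rel_def square_integrable_0)
  show "symp (L2_rel :: ('a \<Rightarrow> complex) \<Rightarrow> _)"
    by (rule sympI) (auto simp: L2_rel_def elim: eventually_mono)
  show "transp (L2_rel :: ('a \<Rightarrow> complex) \<Rightarrow> _)"
  proof (rule transpI)
    fix f g h :: "'a \<Rightarrow> complex"
    assume fg: "L2_rel f g" and gh: "L2_rel g h"
    then have "AE x in lebesgue. f x = g x" "AE x in lebesgue. g x = h x"
      by (simp_all add: L2_rel_def)
    then have "AE x in lebesgue. f x = h x"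
      by eventually_elim simp
    then show "L2_rel f h"
      using fg gh by (simp add: L2_rel_def)
  qed
qed

instantiation L2 :: (euclidean_space) real_inner
begin

lift_definition zero_L2 :: "'a L2" is "\<lambda>_. 0"
  by (simp add: L2_rel_def square_integrable_0)

lift_definition plus_L2 :: "'a L2 \<Rightarrow> 'a L2 \<Rightarrow> 'a L2" is "\<lambda>f g x. f x + g x"
  by (auto simp: L2_rel_def square_integrable_add)

lift_definition minus_L2 :: "'a L2 \<Rightarrow> 'a L2 \<Rightarrow> 'a L2" is "\<lambda>f g x. f x - g x"
  by (auto simp: L2_rel_def square_integrable_diff)

lift_definition uminus_L2 :: "'a L2 \<Rightarrow> 'a L2" is "\<lambda>f x. - f x"
  by (auto simp: L2_rel_def square_integrable_minus)

lift_definition scaleR_L2 :: "real \<Rightarrow> 'a L2 \<Rightarrow> 'a L2" is "\<lambda>r f x. complex_of_real r * f x"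
  by (auto simp: L2_rel_def square_integrable_cmult)

lift_definition norm_L2 :: "'a L2 \<Rightarrow> real" is
  "\<lambda>f. sqrt (LINT x|lebesgue. (cmod (f x))\<^sup>2)"
  by (auto simp: L2_rel_def square_integrable_def intro!: integral_cong_AE)

(* The real part of the Hermitian scalar product. *)
lift_definition inner_L2 :: "'a L2 \<Rightarrow> 'a L2 \<Rightarrow> real" is
  "\<lambda>f g. Re (LINT x|lebesgue. f x * cnj (g x))"
proof -
  fix f f' g g' :: "'a \<Rightarrow> complex"
  assume f: "L2_rel f f'" and g: "L2_rel g g'"
  have "(LINT x|lebesgue. f x * cnj (g x)) = (LINT x|lebesgue. f' x * cnj (g' x))"
  proof (rule integral_cong_AE)
    show "(\<lambda>x. f x * cnj (g x)) \<in> borel_measurable lebesgue"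
      "(\<lambda>x. f' x * cnj (g' x)) \<in> borel_measurable lebesgue"
      using f g integrable_mult_cnj borel_measurable_integrable unfolding L2_rel_def by blast+
    show "AE x in lebesgue. f x * cnj (g x) = f' x * cnj (g' x)"
      using f g by (auto simp: L2_rel_def)
  qed
  then show "Re (LINT x|lebesgue. f x * cnj (g x)) = Re (LINT x|lebesgue. f' x * cnj (g' x))"
    by simp
qed

definition sgn_L2 :: "'a L2 \<Rightarrow> 'a L2" where
  "sgn_L2 u = inverse (norm u) *\<^sub>R u"

definition dist_L2 :: "'a L2 \<Rightarrow> 'a L2 \<Rightarrow> real" where
  "dist_L2 u v = norm (u - v)"

definition uniformity_L2 :: "('a L2 \<times> 'a L2) filter" where
  "uniformity_L2 = (INF e\<in>{0<..}. principal {(u, v). dist u v < e})"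

definition open_L2 :: "'a L2 set \<Rightarrow> bool" where
  "open_L2 U \<longleftrightarrow> (\<forall>u\<in>U. eventually (\<lambda>(u', v). u' = u \<longrightarrow> v \<in> U) uniformity)"

instance
proof
  fix a b c :: "'a L2" and r s :: real
  show "a + b + c = a + (b + c)"
    by transfer (auto simp: L2_rel_def square_integrable_add add.assoc)
  show "a + b = b + a"
    by transfer (auto simp: L2_rel_def square_integrable_add add.commute)
  show "0 + a = a"
    by transfer (auto simp: L2_rel_def)
  show "- a + a = 0"
    by transfer (auto simp: L2_rel_def square_integrable_0)
  show "a - b = a + - b"
    by transfer (auto simp: L2_rel_def square_integrable_diff)
  show "r *\<^sub>R (a + b) = r *\<^sub>R a + r *\<^sub>R b"
    by transfer (auto simp: L2_rel_def square_integrable_add square_integrable_cmult distrib_left)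
  show "(r + s) *\<^sub>R a = r *\<^sub>R a + s *\<^sub>R a"
    by transfer (auto simp: L2_rel_def square_integrable_add square_integrable_cmult distrib_right)
  show "r *\<^sub>R s *\<^sub>R a = (r * s) *\<^sub>R a"
    by transfer (auto simp: L2_rel_def square_integrable_cmult mult.assoc)
  show "1 *\<^sub>R a = a"
    by transfer (auto simp: L2_rel_def)
  show "sgn a = inverse (norm a) *\<^sub>R a"
    by (rule sgn_L2_def)
  show "dist a b = norm (a - b)"
    by (rule dist_L2_def)
  show "uniformity = (INF e\<in>{0<..}. principal {(x, y :: 'a L2). dist x y < e})"
    by (rule uniformity_L2_def)
  show "open U = (\<forall>x\<in>U. \<forall>\<^sub>F (x', y) in uniformity. x' = x \<longrightarrow> y \<in> U)" for U :: "'a L2 set"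
    by (rule open_L2_def)
  show "a \<bullet> b = b \<bullet> a"
  proof transfer
    fix f g :: "'a \<Rightarrow> complex"
    assume "L2_rel f f" "L2_rel g g"
    have "(LINT x|lebesgue. f x * cnj (g x)) = (LINT x|lebesgue. cnj (g x * cnj (f x)))"
      by (simp add: mult.commute)
    also have "\<dots> = cnj (LINT x|lebesgue. g x * cnj (f x))"
      by (rule Bochner_Integration.integral_cnj)
    finally show "Re (LINT x|lebesgue. f x * cnj (g x)) = Re (LINT x|lebesgue. g x * cnj (f x))"
      by simp
  qed
  show "(a + b) \<bullet> c = a \<bullet> c + b \<bullet> c"
    by transfer (simp add: L2_rel_def distrib_right integrable_mult_cnj)
  show "(r *\<^sub>R a) \<bullet> b = r * (a \<bullet> b)"
    by transfer (simp add: mult.assoc)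
  have norm_inner: "norm a = sqrt (a \<bullet> a)"
  proof transfer
    fix f :: "'a \<Rightarrow> complex"
    have "(LINT x|lebesgue. f x * cnj (f x)) = (LINT x|lebesgue. complex_of_real ((cmod (f x))\<^sup>2))"
      by (simp only: complex_norm_square)
    also have "\<dots> = complex_of_real (LINT x|lebesgue. (cmod (f x))\<^sup>2)"
      by (rule integral_complex_of_real)
    finally show "sqrt (LINT x|lebesgue. (cmod (f x))\<^sup>2) = sqrt (Re (LINT x|lebesgue. f x * cnj (f x)))"
      by simp
  qed
  then show "norm a = sqrt (a \<bullet> a)" .
  have norm_ge: "0 \<le> norm a"
    by transfer simp
  then show ge: "0 \<le> a \<bullet> a"
    using norm_inner by simp
  have "norm a = 0 \<longleftrightarrow> a = 0"
    by transfer (auto simp: L2_rel_def square_integrable_0 square_integrable_def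
        integral_nonneg_eq_0_iff_AE)
  then show "(a \<bullet> a = 0) = (a = 0)"
    using norm_inner by simp
qed

end

lift_definition scaleC_L2 :: "complex \<Rightarrow> 'a::euclidean_space L2 \<Rightarrow> 'a L2" is "\<lambda>c f x. c * f x"
  by (auto simp: L2_rel_def square_integrable_cmult)

(* Bounded operators of the complex Hilbert space: the library's bounded_linear only
   yields real-linearity.  The operator norm is onorm. *)
definition bounded_clinear :: "('a::euclidean_space L2 \<Rightarrow> 'a L2) \<Rightarrow> bool" where
  "bounded_clinear A \<longleftrightarrow>
     bounded_linear A \<and> (\<forall>c u. A (scaleC_L2 c u) = scaleC_L2 c (A u))"

(* abs_L2 f is the class of f (meaningful for square-integrable f only), rep_L2 u a representative
   of u chosen once and for all; everything below depends on u only. *)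
definition mult_indicator :: "'a::euclidean_space set \<Rightarrow> 'a L2 \<Rightarrow> 'a L2" where
  "mult_indicator \<omega> u = abs_L2 (\<lambda>x. indicator \<omega> x * rep_L2 u x)"


section \<open>Fourier multipliers\<close>

definition fourier_trunc ::
    "real \<Rightarrow> ('a::euclidean_space \<Rightarrow> complex) \<Rightarrow> 'a \<Rightarrow> complex" where
  "fourier_trunc R f \<xi> =
     (LINT x|lebesgue. indicator (cball 0 R) x * (exp (- (\<i> * complex_of_real (x \<bullet> \<xi>))) * f x))"

(* The Fourier-Plancherel transform as a limit in the mean.  The kernel exp (-i x.xi), without a
   factor 2 pi in the phase, is the one for which D = -i d/dx has symbol xi. The distance is
   a nonnegative integral, so it is infinite (not 0) if the difference is not in L2. *)
definition fourier_L2 :: "'a::euclidean_space L2 \<Rightarrow> 'a L2" where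
  "fourier_L2 u = (THE g. ((\<lambda>R. \<integral>\<^sup>+\<xi>. ennreal ((cmod (fourier_trunc R (rep_L2 u) \<xi> - rep_L2 g \<xi>))\<^sup>2)
      \<partial>lebesgue) \<longlongrightarrow> 0) at_top)"

definition multiplier_dom :: "(real \<Rightarrow> real) \<Rightarrow> 'a::euclidean_space L2 set" where
  "multiplier_dom F =
     {u. square_integrable (\<lambda>\<xi>. complex_of_real (F (norm \<xi>)) * rep_L2 (fourier_L2 u) \<xi>)}"

definition multiplier :: "(real \<Rightarrow> real) \<Rightarrow> 'a::euclidean_space L2 \<Rightarrow> 'a L2" where
  "multiplier F u =
     (THE v. fourier_L2 v = abs_L2 (\<lambda>\<xi>. complex_of_real (F (norm \<xi>)) * rep_L2 (fourier_L2 u) \<xi>))"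


section \<open>Semigroups and stabilizability\<close>

definition C0_semigroup :: "(real \<Rightarrow> 'a::euclidean_space L2 \<Rightarrow> 'a L2) \<Rightarrow> bool" where
  "C0_semigroup T \<longleftrightarrow>
     (\<forall>t\<ge>0. bounded_clinear (T t)) \<and>
     (\<forall>u. T 0 u = u) \<and>
     (\<forall>s\<ge>0. \<forall>t\<ge>0. \<forall>u. T (s + t) u = T s (T t u)) \<and>
     (\<forall>u. ((\<lambda>t. T t u) \<longlongrightarrow> u) (at_right 0))"

(* The infinitesimal generator of T is exactly the operator A with domain D. *)
definition has_generator ::
    "(real \<Rightarrow> 'a::euclidean_space L2 \<Rightarrow> 'a L2) \<Rightarrow> 'a L2 set \<Rightarrow> ('a L2 \<Rightarrow> 'a L2) \<Rightarrow> bool" where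
  "has_generator T D A \<longleftrightarrow>
     (\<forall>u v. ((\<lambda>t. (T t u - u) /\<^sub>R t) \<longlongrightarrow> v) (at_right 0) \<longleftrightarrow> u \<in> D \<and> v = A u)"

(* T t is exp (-t (F(|D|) + B)).  As B is everywhere defined, F(|D|) + B has the domain of F(|D|).
   The semigroup is determined by its generator, so a relation suffices. *)
definition semigroup_of ::
    "(real \<Rightarrow> real) \<Rightarrow> ('a::euclidean_space L2 \<Rightarrow> 'a L2) \<Rightarrow> (real \<Rightarrow> 'a L2 \<Rightarrow> 'a L2) \<Rightarrow> bool" where
  "semigroup_of F B T \<longleftrightarrow>
     C0_semigroup T \<and> has_generator T (multiplier_dom F) (\<lambda>u. - (multiplier F u + B u))"

definition exp_stabilizable ::
    "(real \<Rightarrow> real) \<Rightarrow> 'a::euclidean_space set \<Rightarrow> real \<Rightarrow> bool" where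
  "exp_stabilizable F \<omega> \<alpha> \<longleftrightarrow>
     (\<exists>M\<ge>1. \<exists>K. bounded_clinear K \<and>
        (\<exists>T. semigroup_of F (\<lambda>u. mult_indicator \<omega> (K u)) T \<and>
             (\<forall>t\<ge>0. onorm (T t) \<le> M * exp (- \<alpha> * t))))"

end

theory Submission
  imports Defs "HOL-Probability.Characteristic_Functions" "HOL-Real_Asymp.Real_Asymp"
begin

text \<open>
Write n for the dimension, let A = - (F(|D|) + 1_\<omega> K) generate a closed-loop semigroup T with
|T t| \<le> M exp (- \<alpha> t), and let l be the limit of F, so that l \<le> sup F < \<alpha>.
The obstruction is that, whatever the feedback K, the number - l is an approximate eigenvalue of the
adjoint of A.

Indeed let g be supported in a ball that does not meet \<omega>. Then g is orthogonal to the range of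
1_\<omega> K, so the control is invisible to g. Take for g the L2-normalized indicator of such a ball and let
the radius tend to 0. The L1 norm of g tends to 0, so the Fourier transform of g tends to 0 uniformly,
while its L2 norm is constant; hence its mass escapes to high frequencies, where F is close to l, and
(F(|D|) - l) g becomes small (\<open>normalized_ball_approx_eigenvector\<close>). As F(|D|) is self-adjoint, the
scalar product of g with (A + l) u is at most \<epsilon> |u| in absolute value for every u, with \<epsilon> as small
as desired.

Such an almost invariant direction cannot decay at a rate larger than l
(\<open>semigroup_decay_excludes_approx_eigenvector\<close>). The scalar product of g with T t g, times exp (l t),
is 1 at t = 0 and tends to 0 at infinity because l < \<alpha>; but its derivative is at least
- \<epsilon> M exp (- (\<alpha> - l) t), so that its total decrease is at most \<epsilon> M / (\<alpha> - l) < 1.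
Since F is bounded, the domain of A is the whole space, which makes every orbit differentiable.

Both the multiplier and its self-adjointness rest on the Fourier-Plancherel transform, here the limit in
the mean of truncated Fourier integrals. Most of the text proves that this transform exists, that it
multiplies norms by (2 \<pi>)^(n/2), and that it is onto. Plancherel's identity is obtained for
continuous functions by Gaussian regularisation (\<open>Plancherel_continuous\<close>) and passes to square-integrable
functions of bounded support by dominated limits (\<open>Plancherel_dominated_limit\<close>). Completeness of L2
then provides the transform of every square-integrable function, and the transpose identity
\<open>fourier_L2_transpose\<close> gives the inversion formula.
\<close>

section \<open>Square-integrable functions and their classes\<close>

lemma square_integrable_rep_L2: "square_integrable (rep_L2 u)"
  using Quotient3_rep_reflp[OF Quotient3_L2, of u] by (simp add: L2_rel_def)

lemma L2_rel_refl: "square_integrable f \<Longrightarrow> L2_rel f f"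
  by (simp add: L2_rel_def)

lemma abs_rep_L2: "abs_L2 (rep_L2 u) = u"
  by (rule Quotient3_abs_rep[OF Quotient3_L2])

lemma abs_L2_eq_iff:
  assumes "square_integrable f" "square_integrable g"
  shows "abs_L2 f = abs_L2 g \<longleftrightarrow> (AE x in lebesgue. f x = g x)"
  using Quotient3_rel[OF Quotient3_L2, of f g] assms by (auto simp: L2_rel_def)

lemma rep_abs_L2:
  assumes "square_integrable f"
  shows "AE x in lebesgue. rep_L2 (abs_L2 f) x = f x"
  using abs_L2_eq_iff[OF square_integrable_rep_L2 assms] abs_rep_L2 by blast

lemma abs_L2_add:
  "square_integrable f \<Longrightarrow> square_integrable g \<Longrightarrow> abs_L2 f + abs_L2 g = abs_L2 (\<lambda>x. f x + g x)"
  by (simp add: plus_L2.abs_eq L2_rel_refl)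

lemma abs_L2_diff:
  "square_integrable f \<Longrightarrow> square_integrable g \<Longrightarrow> abs_L2 f - abs_L2 g = abs_L2 (\<lambda>x. f x - g x)"
  by (simp add: minus_L2.abs_eq L2_rel_refl)

lemma abs_L2_scaleR:
  "square_integrable f \<Longrightarrow> r *\<^sub>R abs_L2 f = abs_L2 (\<lambda>x. complex_of_real r * f x)"
  by (simp add: scaleR_L2.abs_eq L2_rel_refl)

lemma norm_abs_L2:
  "square_integrable f \<Longrightarrow> norm (abs_L2 f) = sqrt (LINT x|lebesgue. (cmod (f x))\<^sup>2)"
  by (simp add: norm_L2.abs_eq L2_rel_refl)

lemma inner_abs_L2:
  "square_integrable f \<Longrightarrow> square_integrable g \<Longrightarrow>
     abs_L2 f \<bullet> abs_L2 g = Re (LINT x|lebesgue. f x * cnj (g x))"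
  by (simp add: inner_L2.abs_eq L2_rel_refl)

lemma power2_norm_abs_L2:
  "square_integrable f \<Longrightarrow> (norm (abs_L2 f))\<^sup>2 = (LINT x|lebesgue. (cmod (f x))\<^sup>2)"
  by (simp add: norm_abs_L2)

lemma nn_integral_square_integrable:
  "square_integrable f \<Longrightarrow> (\<integral>\<^sup>+x. ennreal ((cmod (f x))\<^sup>2) \<partial>lebesgue) = ennreal ((norm (abs_L2 f))\<^sup>2)"
  by (simp add: power2_norm_abs_L2 square_integrable_def nn_integral_eq_integral)

lemma square_integrable_iff_nn_integral:
  assumes "f \<in> borel_measurable lebesgue"
  shows "square_integrable f \<longleftrightarrow> (\<integral>\<^sup>+x. ennreal ((cmod (f x))\<^sup>2) \<partial>lebesgue) < \<infinity>"
  using assms by (auto simp: square_integrable_def integrable_iff_bounded)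

lemma square_integrable_bound:
  assumes "f \<in> borel_measurable lebesgue" "square_integrable g"
    and "\<And>x. cmod (f x) \<le> cmod (g x)"
  shows "square_integrable f"
  unfolding square_integrable_def
proof (intro conjI assms(1))
  have [measurable]: "f \<in> borel_measurable lebesgue" by fact
  show "integrable lebesgue (\<lambda>x. (cmod (f x))\<^sup>2)"
    by (rule Bochner_Integration.integrable_bound[where f = "\<lambda>x. (cmod (g x))\<^sup>2"])
       (use assms in \<open>auto simp: square_integrable_def power_mono\<close>)
qed

lemma square_integrable_indicator_mult:
  assumes "square_integrable f" "S \<in> sets lebesgue"
  shows "square_integrable (\<lambda>x. indicator S x * f x)"
proof (rule square_integrable_bound[OF _ assms(1)])
  show "(\<lambda>x. indicator S x * f x) \<in> borel_measurable lebesgue"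
    using assms by (auto simp: square_integrable_def)
qed (auto simp: indicator_def)

text \<open>
Fubini's theorem is applied to Lebesgue measurable representatives, hence to the product of two
completed measures.
\<close>

lemma sigma_finite_lebesgue: "sigma_finite_measure (lebesgue :: 'a::euclidean_space measure)"
proof
  show "\<exists>A::'a set set. countable A \<and> A \<subseteq> sets lebesgue \<and> \<Union>A = space lebesgue \<and>
      (\<forall>a\<in>A. emeasure lebesgue a \<noteq> \<infinity>)"
  proof (intro exI conjI ballI)
    show "countable (range (\<lambda>n::nat. cball (0::'a) (real n)))" by simp
    show "\<Union> (range (\<lambda>n::nat. cball (0::'a) (real n))) = space lebesgue"
      using real_arch_simple by (auto simp: dist_norm)
    show "emeasure lebesgue a \<noteq> \<infinity>" if mem: "a \<in> range (\<lambda>n::nat. cball (0::'a) (real n))" for a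
    proof -
      obtain n where a: "a = cball 0 (real n)" using mem by auto
      have "emeasure lborel (cball (0::'a) (real n)) < \<infinity>"
        by (rule emeasure_lborel_cball_finite)
      then show ?thesis unfolding a by (simp add: less_top)
    qed
  qed auto
qed

text \<open>
Fatou's lemma in the form used below: it provides square integrability of a pointwise limit together
with the norm estimate.
\<close>

lemma square_integrable_Fatou:
  fixes h :: "nat \<Rightarrow> 'a::euclidean_space \<Rightarrow> complex"
  assumes h: "\<And>j. square_integrable (h j)" and f: "f \<in> borel_measurable lebesgue"
    and lim: "AE x in lebesgue. (\<lambda>j. h j x) \<longlonglongrightarrow> f x"
    and bound: "eventually (\<lambda>j. norm (abs_L2 (h j)) \<le> C) sequentially"
  shows "square_integrable f" "norm (abs_L2 f) \<le> C"
proof -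
  have [measurable]: "\<And>j. h j \<in> borel_measurable lebesgue" "f \<in> borel_measurable lebesgue"
    using h f by (auto simp: square_integrable_def)
  obtain j where "norm (abs_L2 (h j)) \<le> C"
    using bound eventually_sequentially by auto
  then have C: "C \<ge> 0" using norm_ge_zero order_trans by blast
  have "(\<integral>\<^sup>+x. ennreal ((cmod (f x))\<^sup>2) \<partial>lebesgue)
      = (\<integral>\<^sup>+x. liminf (\<lambda>j. ennreal ((cmod (h j x))\<^sup>2)) \<partial>lebesgue)"
  proof (rule nn_integral_cong_AE, use lim in eventually_elim)
    fix x assume "(\<lambda>j. h j x) \<longlonglongrightarrow> f x"
    then have "(\<lambda>j. ennreal ((cmod (h j x))\<^sup>2)) \<longlonglongrightarrow> ennreal ((cmod (f x))\<^sup>2)"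
      by (intro tendsto_ennrealI tendsto_intros)
    then show "ennreal ((cmod (f x))\<^sup>2) = liminf (\<lambda>j. ennreal ((cmod (h j x))\<^sup>2))"
      by (intro lim_imp_Liminf[symmetric]) auto
  qed
  also have "\<dots> \<le> liminf (\<lambda>j. \<integral>\<^sup>+x. ennreal ((cmod (h j x))\<^sup>2) \<partial>lebesgue)"
    by (intro nn_integral_liminf) measurable
  also have "\<dots> \<le> liminf (\<lambda>j. ennreal (C\<^sup>2))"
  proof (rule Liminf_mono, use bound in eventually_elim)
    fix j assume "norm (abs_L2 (h j)) \<le> C"
    then show "(\<integral>\<^sup>+x. ennreal ((cmod (h j x))\<^sup>2) \<partial>lebesgue) \<le> ennreal (C\<^sup>2)"
      using h by (simp add: nn_integral_square_integrable power_mono)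
  qed
  also have "\<dots> = ennreal (C\<^sup>2)" by (rule Liminf_const) simp
  finally have *: "(\<integral>\<^sup>+x. ennreal ((cmod (f x))\<^sup>2) \<partial>lebesgue) \<le> ennreal (C\<^sup>2)" .
  then show sq: "square_integrable f"
    using f by (simp add: square_integrable_iff_nn_integral le_less_trans)
  show "norm (abs_L2 f) \<le> C"
    using * C sq by (simp add: nn_integral_square_integrable power2_le_iff_abs_le)
qed

text \<open>
If d j is the j-th increment, the sum of all 2^j |d j|^2 has finite integral, so it is finite almost
everywhere. There the increments are summable, because the arithmetic-geometric mean inequality bounds
2 |d j| by 2^j |d j|^2 + 2^(-j).
\<close>

lemma rapidly_Cauchy_L2_AE_convergent:
  fixes h :: "nat \<Rightarrow> 'a::euclidean_space \<Rightarrow> complex"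
  assumes h: "\<And>j. square_integrable (h j)"
    and fast: "\<And>j. norm (abs_L2 (h (Suc j)) - abs_L2 (h j)) \<le> (1/2) ^ j"
  shows "AE x in lebesgue. convergent (\<lambda>j. h j x)"
proof -
  have [measurable]: "\<And>j. h j \<in> borel_measurable lebesgue"
    using h by (auto simp: square_integrable_def)
  define d where "d j x = h (Suc j) x - h j x" for j x
  have d: "square_integrable (d j)" for j
    unfolding d_def by (intro square_integrable_diff h)
  have [measurable]: "\<And>j. d j \<in> borel_measurable lebesgue"
    using d by (auto simp: square_integrable_def)
  have le: "(\<integral>\<^sup>+x. ennreal (2 ^ j * (cmod (d j x))\<^sup>2) \<partial>lebesgue) \<le> ennreal ((1/2) ^ j)" for j
  proof -
    have "(norm (abs_L2 (d j)))\<^sup>2 \<le> ((1/2) ^ j)\<^sup>2"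
      using fast[of j] by (intro power_mono) (auto simp: abs_L2_diff h d_def[abs_def])
    then have "2 ^ j * (norm (abs_L2 (d j)))\<^sup>2 \<le> 2 ^ j * ((1/2) ^ j)\<^sup>2"
      by (intro mult_left_mono) auto
    also have "\<dots> = (1/2) ^ j"
      by (simp add: power2_eq_square power_one_over)
    finally have le: "2 ^ j * (norm (abs_L2 (d j)))\<^sup>2 \<le> (1/2) ^ j" .
    have "(\<integral>\<^sup>+x. ennreal (2 ^ j * (cmod (d j x))\<^sup>2) \<partial>lebesgue)
        = ennreal (2 ^ j) * (\<integral>\<^sup>+x. ennreal ((cmod (d j x))\<^sup>2) \<partial>lebesgue)"
      by (subst nn_integral_cmult[symmetric]) (auto intro!: nn_integral_cong simp: ennreal_mult)
    also have "\<dots> = ennreal (2 ^ j * (norm (abs_L2 (d j)))\<^sup>2)"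
      by (subst nn_integral_square_integrable[OF d]) (auto simp: ennreal_mult)
    also have "\<dots> \<le> ennreal ((1/2) ^ j)"
      using le by (rule ennreal_leI)
    finally show ?thesis .
  qed
  have "(\<integral>\<^sup>+x. (\<Sum>j. ennreal (2 ^ j * (cmod (d j x))\<^sup>2)) \<partial>lebesgue)
      = (\<Sum>j. \<integral>\<^sup>+x. ennreal (2 ^ j * (cmod (d j x))\<^sup>2) \<partial>lebesgue)"
    by (intro nn_integral_suminf) measurable
  also have "\<dots> \<le> (\<Sum>j. ennreal ((1/2) ^ j))"
    by (intro suminf_le le) auto
  also have "\<dots> < \<infinity>"
    by (subst suminf_ennreal2) (auto intro: summable_geometric)
  finally have "AE x in lebesgue. (\<Sum>j. ennreal (2 ^ j * (cmod (d j x))\<^sup>2)) \<noteq> \<infinity>"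
    by (intro nn_integral_PInf_AE) auto
  then show ?thesis
  proof eventually_elim
    fix x assume "(\<Sum>j. ennreal (2 ^ j * (cmod (d j x))\<^sup>2)) \<noteq> \<infinity>"
    then have "summable (\<lambda>j. 2 ^ j * (cmod (d j x))\<^sup>2)"
      by (intro summable_suminf_not_top) auto
    then have "summable (\<lambda>j. 2 ^ j * (cmod (d j x))\<^sup>2 + (1/2) ^ j)"
      by (intro summable_add summable_geometric) auto
    then have "summable (\<lambda>j. d j x)"
    proof (rule summable_comparison_test'[of _ 0])
      fix j :: nat
      let ?a = "sqrt (2 ^ j)"
      have "2 * (?a * cmod (d j x)) * (1 / ?a) \<le> (?a * cmod (d j x))\<^sup>2 + (1 / ?a)\<^sup>2"
        by (rule sum_squares_bound)
      then have "2 * cmod (d j x) \<le> 2 ^ j * (cmod (d j x))\<^sup>2 + (1/2) ^ j"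
        by (simp add: power_mult_distrib power_divide power_one_over)
      then show "norm (d j x) \<le> 2 ^ j * (cmod (d j x))\<^sup>2 + (1/2) ^ j"
        using norm_ge_zero[of "d j x"] by linarith
    qed
    then have "convergent (\<lambda>n. \<Sum>j<n. d j x)"
      by (simp add: summable_iff_convergent)
    moreover have "(\<Sum>j<n. d j x) = h n x - h 0 x" for n
      using sum_lessThan_telescope[of "\<lambda>j. h j x" n] by (simp add: d_def)
    ultimately have "convergent (\<lambda>n. h n x - h 0 x)" by simp
    then show "convergent (\<lambda>j. h j x)"
      using convergent_add_const_right_iff[of "\<lambda>n. h n x" "- h 0 x"] by simp
  qed
qed

text \<open>
The Riesz-Fischer theorem: a subsequence converges almost everywhere, and Fatou's lemma turns this
pointwise limit into a limit in norm.
\<close>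

instance L2 :: (euclidean_space) banach
proof
  fix X :: "nat \<Rightarrow> 'a L2"
  assume X: "Cauchy X"
  have "\<exists>N. \<forall>m\<ge>N. \<forall>n\<ge>N. norm (X m - X n) < (1/2) ^ j" for j :: nat
    using X unfolding Cauchy_iff by simp
  then obtain N where N: "\<And>j m n. m \<ge> N j \<Longrightarrow> n \<ge> N j \<Longrightarrow> norm (X m - X n) < (1/2) ^ j"
    by metis
  \<comment> \<open>The partial sums of N are monotone and dominate N, so they index a rapidly Cauchy subsequence.\<close>
  define s where "s j = (\<Sum>i\<le>j. N i)" for j
  have s: "s j \<ge> N j" for j
    unfolding s_def by (rule member_le_sum) auto
  have s_Suc: "s (Suc j) \<ge> s j" for j
    by (simp add: s_def)
  define h where "h j = rep_L2 (X (s j))" for j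
  have h: "square_integrable (h j)" "abs_L2 (h j) = X (s j)" for j
    by (auto simp: h_def square_integrable_rep_L2 abs_rep_L2)
  have [measurable]: "\<And>j. h j \<in> borel_measurable lebesgue"
    using h by (auto simp: square_integrable_def)
  define f where "f x = lim (\<lambda>j. h j x)" for x
  have [measurable]: "f \<in> borel_measurable lebesgue"
    unfolding f_def by measurable
  have "AE x in lebesgue. convergent (\<lambda>j. h j x)"
    using h(1)
  proof (rule rapidly_Cauchy_L2_AE_convergent)
    show "norm (abs_L2 (h (Suc j)) - abs_L2 (h j)) \<le> (1/2) ^ j" for j
      using N[of j "s (Suc j)" "s j"] s[of j] s_Suc[of j] by (simp add: h)
  qed
  then have lim: "AE x in lebesgue. (\<lambda>j. h j x) \<longlonglongrightarrow> f x"
    by eventually_elim (simp add: f_def convergent_LIMSEQ_iff)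
  have close: "square_integrable (\<lambda>x. h i x - f x)"
    "norm (abs_L2 (\<lambda>x. h i x - f x)) \<le> (1/2) ^ i" for i
  proof -
    have lim': "AE x in lebesgue. (\<lambda>j. h i x - h j x) \<longlonglongrightarrow> h i x - f x"
      using lim by eventually_elim (auto intro: tendsto_intros)
    have "norm (abs_L2 (\<lambda>x. h i x - h j x)) \<le> (1/2) ^ i" if "j \<ge> i" for j
    proof -
      have "s j \<ge> s i" using that s_Suc by (rule lift_Suc_mono_le[rotated])
      then show ?thesis
        using N[of i "s i" "s j"] s[of i] by (simp add: h flip: abs_L2_diff)
    qed
    then have ev: "eventually (\<lambda>j. norm (abs_L2 (\<lambda>x. h i x - h j x)) \<le> (1/2) ^ i) sequentially"
      using eventually_sequentially by blast
    show "square_integrable (\<lambda>x. h i x - f x)" "norm (abs_L2 (\<lambda>x. h i x - f x)) \<le> (1/2) ^ i"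
      using square_integrable_Fatou[OF _ _ lim' ev] h(1) by (auto intro: square_integrable_diff)
  qed
  have f: "square_integrable f"
    using square_integrable_diff[OF h(1)[of 0] close(1)[of 0]] by simp
  show "convergent X"
  proof (rule convergentI, rule LIMSEQ_I)
    fix r :: real assume "r > 0"
    then obtain i where i: "(1/2) ^ i < r / 2"
      using real_arch_pow_inv[of "r/2" "1/2"] by auto
    have "norm (X n - abs_L2 f) < r" if "n \<ge> N i" for n
    proof -
      have "norm (X n - abs_L2 f) \<le> norm (X n - X (s i)) + norm (X (s i) - abs_L2 f)"
        using norm_triangle_ineq[of "X n - X (s i)" "X (s i) - abs_L2 f"] by simp
      also have "norm (X (s i) - abs_L2 f) \<le> (1/2) ^ i"
        using close(2)[of i] by (simp add: f h(1) flip: abs_L2_diff h(2))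
      also have "norm (X n - X (s i)) < (1/2) ^ i"
        using N[of i n "s i"] that s[of i] by simp
      finally show ?thesis using i by simp
    qed
    then show "\<exists>no. \<forall>n\<ge>no. norm (X n - abs_L2 f) < r" by blast
  qed
qed

section \<open>The Fourier integral\<close>

definition fourier_integral :: "('a::euclidean_space \<Rightarrow> complex) \<Rightarrow> 'a \<Rightarrow> complex" where
  "fourier_integral f \<xi> = (LINT x|lebesgue. exp (- (\<i> * complex_of_real (x \<bullet> \<xi>))) * f x)"

lemma norm_fourier_kernel: "cmod (exp (- (\<i> * complex_of_real t))) = 1"
  using norm_exp_i_times[of "- t"] by simp

lemma measurable_lebesgue_borel: "(\<lambda>x. x) \<in> lebesgue \<rightarrow>\<^sub>M borel"
  by (rule measurable_completion) simp

lemma measurable_fourier_kernel: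
  "(\<lambda>(x, \<xi>). exp (- (\<i> * complex_of_real (x \<bullet> \<xi>))))
     \<in> borel_measurable (lebesgue \<Otimes>\<^sub>M (lebesgue :: 'a::euclidean_space measure))"
proof -
  have [measurable]: "fst \<in> (lebesgue \<Otimes>\<^sub>M lebesgue :: ('a \<times> 'a) measure) \<rightarrow>\<^sub>M borel"
    "snd \<in> (lebesgue \<Otimes>\<^sub>M lebesgue :: ('a \<times> 'a) measure) \<rightarrow>\<^sub>M borel"
    using measurable_compose[OF measurable_fst measurable_lebesgue_borel]
      measurable_compose[OF measurable_snd measurable_lebesgue_borel] by auto
  show ?thesis unfolding split_beta by measurable
qed

lemma integrable_fourier_kernel_mult:
  assumes "integrable lebesgue f"
  shows "integrable lebesgue (\<lambda>x. exp (- (\<i> * complex_of_real (x \<bullet> \<xi>))) * f x)"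
proof (rule Bochner_Integration.integrable_bound[OF assms])
  have [measurable]: "f \<in> borel_measurable lebesgue" using assms by auto
  note measurable_lebesgue_borel[measurable]
  show "(\<lambda>x. exp (- (\<i> * complex_of_real (x \<bullet> \<xi>))) * f x) \<in> borel_measurable lebesgue"
    by measurable
qed (simp add: norm_mult norm_fourier_kernel)

lemma norm_fourier_integral_le:
  "cmod (fourier_integral f \<xi>) \<le> (LINT x|lebesgue. cmod (f x))"
  unfolding fourier_integral_def
  using integral_norm_bound[of lebesgue "\<lambda>x. exp (- (\<i> * complex_of_real (x \<bullet> \<xi>))) * f x"]
  by (simp add: norm_mult norm_fourier_kernel)

lemma fourier_integral_diff:
  assumes "integrable lebesgue f" "integrable lebesgue g"
  shows "fourier_integral (\<lambda>x. f x - g x) \<xi> = fourier_integral f \<xi> - fourier_integral g \<xi>"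
  unfolding fourier_integral_def
  using assms by (simp add: ring_distribs integrable_fourier_kernel_mult)

lemma fourier_integral_add:
  assumes "integrable lebesgue f" "integrable lebesgue g"
  shows "fourier_integral (\<lambda>x. f x + g x) \<xi> = fourier_integral f \<xi> + fourier_integral g \<xi>"
  unfolding fourier_integral_def
  using assms by (simp add: ring_distribs integrable_fourier_kernel_mult)

lemma fourier_integral_cong_AE:
  assumes "f \<in> borel_measurable lebesgue" "g \<in> borel_measurable lebesgue"
    and "AE x in lebesgue. f x = g x"
  shows "fourier_integral f = fourier_integral g"
proof
  have [measurable]: "f \<in> borel_measurable lebesgue" "g \<in> borel_measurable lebesgue" by fact+
  note measurable_lebesgue_borel[measurable]
  show "fourier_integral f \<xi> = fourier_integral g \<xi>" for \<xi>
    unfolding fourier_integral_def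
    by (rule integral_cong_AE) (use assms in auto)
qed

lemma borel_measurable_fourier_integral:
  fixes f :: "'a::euclidean_space \<Rightarrow> complex"
  assumes "f \<in> borel_measurable lebesgue"
  shows "fourier_integral f \<in> borel_measurable lebesgue"
proof -
  have [measurable]: "f \<in> borel_measurable lebesgue" by fact
  note measurable_fourier_kernel[measurable]
  have [measurable]: "(\<lambda>(\<xi>, x). exp (- (\<i> * complex_of_real (x \<bullet> \<xi>))))
     \<in> borel_measurable (lebesgue \<Otimes>\<^sub>M (lebesgue :: 'a::euclidean_space measure))"
    using measurable_fourier_kernel by (simp add: inner_commute)
  show ?thesis
    unfolding fourier_integral_def
    by (rule sigma_finite_measure.borel_measurable_lebesgue_integral[OF sigma_finite_lebesgue])
       measurable
qed

text \<open>
Both sides are the double integral of exp (- i x.\<xi>) f x g \<xi>. This identity carries all uses of Fubini's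
theorem below.
\<close>

lemma fourier_integral_mult_formula:
  fixes f g :: "'a::euclidean_space \<Rightarrow> complex"
  assumes f: "integrable lebesgue f" and g: "integrable lebesgue g"
  shows "(LINT \<xi>|lebesgue. fourier_integral f \<xi> * g \<xi>) = (LINT x|lebesgue. f x * fourier_integral g x)"
proof -
  interpret lb: sigma_finite_measure "lebesgue :: 'a measure" by (rule sigma_finite_lebesgue)
  interpret pair_sigma_finite "lebesgue :: 'a measure" "lebesgue :: 'a measure" ..
  have [measurable]: "f \<in> borel_measurable lebesgue" "g \<in> borel_measurable lebesgue"
    using f g by auto
  note measurable_fourier_kernel[measurable]
  have "integrable (lebesgue \<Otimes>\<^sub>M lebesgue)
     (\<lambda>(x, \<xi>). exp (- (\<i> * complex_of_real (x \<bullet> \<xi>))) * f x * g \<xi>)"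
  proof (rule Fubini_integrable)
    show "(\<lambda>(x, \<xi>). exp (- (\<i> * complex_of_real (x \<bullet> \<xi>))) * f x * g \<xi>)
        \<in> borel_measurable (lebesgue \<Otimes>\<^sub>M lebesgue)"
      by measurable
    show "integrable lebesgue (\<lambda>x. LINT y|lebesgue.
        cmod (case (x, y) of (x, \<xi>) \<Rightarrow> exp (- (\<i> * complex_of_real (x \<bullet> \<xi>))) * f x * g \<xi>))"
      using f by (simp add: norm_mult norm_fourier_kernel)
    show "AE x in lebesgue. integrable lebesgue (\<lambda>y. case (x, y) of (x, \<xi>) \<Rightarrow>
        exp (- (\<i> * complex_of_real (x \<bullet> \<xi>))) * f x * g \<xi>)"
      using integrable_mult_right[OF integrable_fourier_kernel_mult[OF g]]
      by (simp add: inner_commute mult_ac)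
  qed
  from Fubini_integral[OF this]
  have "(LINT \<xi>|lebesgue. LINT x|lebesgue. exp (- (\<i> * complex_of_real (x \<bullet> \<xi>))) * f x * g \<xi>)
      = (LINT x|lebesgue. LINT \<xi>|lebesgue. exp (- (\<i> * complex_of_real (x \<bullet> \<xi>))) * f x * g \<xi>)" .
  also have "\<dots> = (LINT x|lebesgue. LINT \<xi>|lebesgue. f x * (exp (- (\<i> * complex_of_real (\<xi> \<bullet> x))) * g \<xi>))"
    by (simp add: inner_commute mult_ac)
  finally show ?thesis
    by (simp add: fourier_integral_def)
qed

section \<open>The Gaussian\<close>

lemma lborel_integral_prod_Basis:
  fixes h :: "'a::euclidean_space \<Rightarrow> real \<Rightarrow> complex"
  assumes "\<And>b. b \<in> Basis \<Longrightarrow> integrable lborel (h b)"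
  shows "integrable lborel (\<lambda>x. \<Prod>b\<in>Basis. h b (x \<bullet> b))"
    and "(LINT x|lborel. (\<Prod>b\<in>Basis. h b (x \<bullet> b))) = (\<Prod>b\<in>Basis. LINT t|lborel. h b t)"
proof -
  interpret product_sigma_finite "\<lambda>_::'a. lborel :: real measure" ..
  have h [measurable]: "h b \<in> borel_measurable borel" if "b \<in> Basis" for b
    using assms[OF that] by auto
  have m: "(\<lambda>x. \<Prod>b\<in>Basis. h b (x \<bullet> b)) \<in> borel_measurable borel"
    by measurable
  have T: "(\<lambda>f. \<Sum>b\<in>Basis. f b *\<^sub>R b) \<in> (\<Pi>\<^sub>M b\<in>(Basis::'a set). lborel) \<rightarrow>\<^sub>M borel"
    by measurable
  have eq: "(\<Prod>b\<in>Basis. h b ((\<Sum>c\<in>Basis. f c *\<^sub>R c) \<bullet> b)) = (\<Prod>b\<in>Basis. h b (f b))" for f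
    by (rule prod.cong) (auto simp: inner_sum_left inner_Basis if_distrib cong: if_cong)
  show "integrable lborel (\<lambda>x. \<Prod>b\<in>Basis. h b (x \<bullet> b))"
    by (subst lborel_eq, subst integrable_distr_eq[OF T m], unfold eq)
       (intro product_integrable_prod assms finite_Basis)
  show "(LINT x|lborel. (\<Prod>b\<in>Basis. h b (x \<bullet> b))) = (\<Prod>b\<in>Basis. LINT t|lborel. h b t)"
    by (subst lborel_eq, subst integral_distr[OF T m], unfold eq)
       (intro product_integral_prod assms finite_Basis)
qed

text \<open>
Up to normalisation this is the characteristic function of the standard normal distribution.
\<close>

lemma fourier_gaussian_real:
  "integrable lborel (\<lambda>t. exp (- (\<i> * complex_of_real (t * s))) * complex_of_real (exp (- t\<^sup>2 / 2)))"
  "(LINT t|lborel. exp (- (\<i> * complex_of_real (t * s))) * complex_of_real (exp (- t\<^sup>2 / 2)))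
     = complex_of_real (sqrt (2 * pi) * exp (- s\<^sup>2 / 2))"
proof -
  have eq: "exp (- (\<i> * complex_of_real (t * s))) * complex_of_real (exp (- t\<^sup>2 / 2))
      = complex_of_real (sqrt (2 * pi)) * (std_normal_density t *\<^sub>R iexp (- s * t))" for t
    by (simp add: std_normal_density_def scaleR_conv_of_real mult_ac)
  have int: "integrable lborel (\<lambda>t. std_normal_density t *\<^sub>R iexp (- s * t))"
    by (rule Bochner_Integration.integrable_bound[OF integrable_normal_density[of 1 0]])
       (auto simp: norm_mult)
  then show "integrable lborel (\<lambda>t. exp (- (\<i> * complex_of_real (t * s))) * complex_of_real (exp (- t\<^sup>2 / 2)))"
    unfolding eq by (rule integrable_mult_right)
  have "(LINT t|lborel. std_normal_density t *\<^sub>R iexp (- s * t)) = char std_normal_distribution (- s)"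
    unfolding char_def by (subst integral_density) auto
  also have "\<dots> = complex_of_real (exp (- s\<^sup>2 / 2))"
    by (simp add: char_std_normal_distribution)
  finally show "(LINT t|lborel. exp (- (\<i> * complex_of_real (t * s))) * complex_of_real (exp (- t\<^sup>2 / 2)))
     = complex_of_real (sqrt (2 * pi) * exp (- s\<^sup>2 / 2))"
    unfolding eq by (simp only: integral_mult_right_zero of_real_mult)
qed

definition gaussian :: "'a::euclidean_space \<Rightarrow> real" where
  "gaussian x = exp (- (norm x)\<^sup>2 / 2)"

lemma gaussian_bounds: "0 < gaussian x" "gaussian x \<le> 1"
  by (auto simp: gaussian_def)

lemma continuous_gaussian: "continuous_on UNIV gaussian"
  unfolding gaussian_def by (intro continuous_intros) auto

lemma borel_measurable_gaussian [measurable]: "gaussian \<in> borel_measurable borel"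
  by (rule borel_measurable_continuous_onI[OF continuous_gaussian])

lemma fourier_gaussian:
  fixes \<xi> :: "'a::euclidean_space"
  shows "integrable lborel (\<lambda>x::'a. complex_of_real (gaussian x))"
    and "(LINT x|lborel. exp (- (\<i> * complex_of_real (x \<bullet> \<xi>))) * complex_of_real (gaussian x))
      = complex_of_real (sqrt (2 * pi) ^ DIM('a) * gaussian \<xi>)"
proof -
  have sq: "(norm x)\<^sup>2 = (\<Sum>b\<in>Basis. (x \<bullet> b)\<^sup>2)" for x :: 'a
    using euclidean_inner[of x x] by (simp add: power2_eq_square flip: power2_norm_eq_inner)
  have gauss: "gaussian x = (\<Prod>b\<in>Basis. exp (- (x \<bullet> b)\<^sup>2 / 2))" for x :: 'a
    unfolding gaussian_def sq by (simp add: exp_sum sum_negf sum_divide_distrib flip: sum_negf)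
  have ker: "exp (- (\<i> * complex_of_real (x \<bullet> \<xi>))) = (\<Prod>b\<in>Basis. exp (- (\<i> * complex_of_real ((x \<bullet> b) * (\<xi> \<bullet> b)))))"
    for x \<xi> :: 'a
    by (subst exp_sum[symmetric]) (auto simp: euclidean_inner[of x \<xi>] sum_distrib_left sum_negf)
  have eq: "exp (- (\<i> * complex_of_real (x \<bullet> \<xi>))) * complex_of_real (gaussian x)
      = (\<Prod>b\<in>Basis. exp (- (\<i> * complex_of_real ((x \<bullet> b) * (\<xi> \<bullet> b)))) * complex_of_real (exp (- (x \<bullet> b)\<^sup>2 / 2)))"
    for x \<xi> :: 'a
    unfolding gauss ker by (simp add: prod.distrib)
  note I = lborel_integral_prod_Basis[where h = "\<lambda>b t. exp (- (\<i> * complex_of_real (t * (\<xi> \<bullet> b)))) * complex_of_real (exp (- t\<^sup>2 / 2))"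
      for \<xi> :: 'a, OF fourier_gaussian_real(1)]
  show "(LINT x|lborel. exp (- (\<i> * complex_of_real (x \<bullet> \<xi>))) * complex_of_real (gaussian x))
      = complex_of_real (sqrt (2 * pi) ^ DIM('a) * gaussian \<xi>)"
    unfolding eq I(2) fourier_gaussian_real(2) unfolding gauss by (simp add: prod.distrib)
  show "integrable lborel (\<lambda>x::'a. complex_of_real (gaussian x))"
    using lborel_integral_prod_Basis(1)[where h = "\<lambda>(b::'a) t. exp (- (\<i> * complex_of_real (t * (0 \<bullet> b)))) * complex_of_real (exp (- t\<^sup>2 / 2))",
        OF fourier_gaussian_real(1), folded eq] by simp
qed

section \<open>Plancherel's identity for continuous functions\<close>

lemma integral_lborel_affine:
  fixes g :: "'a::euclidean_space \<Rightarrow> complex"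
  assumes [measurable]: "g \<in> borel_measurable borel" and "\<epsilon> > 0"
  shows "(LINT x|lborel. g x) = complex_of_real (\<epsilon> ^ DIM('a)) * (LINT x|lborel. g (t + \<epsilon> *\<^sub>R x))"
  by (subst lborel_affine[of \<epsilon> t])
     (use assms in \<open>auto simp: integral_density integral_distr scaleR_conv_of_real\<close>)

lemma integrable_gaussian_scaled:
  assumes "\<epsilon> > 0"
  shows "integrable lebesgue (\<lambda>x::'a::euclidean_space. complex_of_real (gaussian (\<epsilon> *\<^sub>R x)))"
proof -
  have "integrable (density (distr lborel borel (\<lambda>x. 0 + \<epsilon> *\<^sub>R x)) (\<lambda>_. \<bar>\<epsilon>\<bar>^DIM('a))) (\<lambda>x::'a. complex_of_real (gaussian x))"
    using lborel_affine[of \<epsilon> "0::'a"] fourier_gaussian(1)[where 'a = 'a] assms by simp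
  then have "integrable lborel (\<lambda>x::'a. complex_of_real (gaussian (\<epsilon> *\<^sub>R x)))"
    using assms integrable_scaleR_right[of "inverse (\<epsilon> ^ DIM('a))" lborel
        "\<lambda>x::'a. (\<epsilon> ^ DIM('a)) *\<^sub>R complex_of_real (gaussian (\<epsilon> *\<^sub>R x))"]
    by (subst (asm) integrable_density) (auto simp: integrable_distr_eq)
  then show ?thesis
    by (subst integrable_completion) auto
qed

lemma fourier_integral_gaussian_scaled:
  fixes z :: "'a::euclidean_space"
  assumes "\<epsilon> > 0"
  shows "complex_of_real (\<epsilon> ^ DIM('a)) * fourier_integral (\<lambda>\<xi>. complex_of_real (gaussian (\<epsilon> *\<^sub>R \<xi>))) z
    = complex_of_real (sqrt (2 * pi) ^ DIM('a) * gaussian (z /\<^sub>R \<epsilon>))"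
proof -
  let ?h = "\<lambda>\<xi>::'a. exp (- (\<i> * complex_of_real (\<xi> \<bullet> (z /\<^sub>R \<epsilon>)))) * complex_of_real (gaussian \<xi>)"
  have "complex_of_real (sqrt (2 * pi) ^ DIM('a) * gaussian (z /\<^sub>R \<epsilon>)) = (LINT \<xi>|lborel. ?h \<xi>)"
    by (rule fourier_gaussian(2)[symmetric])
  also have "\<dots> = complex_of_real (\<epsilon> ^ DIM('a)) * (LINT \<xi>|lborel. ?h (0 + \<epsilon> *\<^sub>R \<xi>))"
    by (rule integral_lborel_affine) (use assms in auto)
  also have "(LINT \<xi>|lborel. ?h (0 + \<epsilon> *\<^sub>R \<xi>))
      = fourier_integral (\<lambda>\<xi>. complex_of_real (gaussian (\<epsilon> *\<^sub>R \<xi>))) z"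
    unfolding fourier_integral_def using assms by (subst integral_completion) (auto simp flip: mult.assoc of_real_mult)
  finally show ?thesis ..
qed

text \<open>
With the Gaussian weight every integral converges absolutely, and applying the multiplication formula
twice moves both transforms away from f: what remains is the transform of the Gaussian, a Gaussian
concentrated at scale \<epsilon> near the diagonal. After rescaling it becomes the average s of f over
\<epsilon>-translates.
\<close>

lemma regularised_Plancherel:
  fixes f :: "'a::euclidean_space \<Rightarrow> complex"
  assumes cont: "continuous_on UNIV f" and int: "integrable lebesgue f" and \<epsilon>: "\<epsilon> > 0"
  defines "s \<equiv> \<lambda>x. LINT z|lborel. complex_of_real (gaussian z) * f (x + \<epsilon> *\<^sub>R z)"
  shows "integrable lebesgue (\<lambda>\<xi>. gaussian (\<epsilon> *\<^sub>R \<xi>) * (cmod (fourier_integral f \<xi>))\<^sup>2)"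
    and "complex_of_real (LINT \<xi>|lebesgue. gaussian (\<epsilon> *\<^sub>R \<xi>) * (cmod (fourier_integral f \<xi>))\<^sup>2)
      = complex_of_real (sqrt (2 * pi) ^ DIM('a)) * (LINT x|lebesgue. f x * cnj (s x))"
proof -
  let ?c = "complex_of_real (sqrt (2 * pi) ^ DIM('a))"
  let ?B = "LINT x|lebesgue. cmod (f x)"
  let ?w = "\<lambda>\<xi>::'a. complex_of_real (gaussian (\<epsilon> *\<^sub>R \<xi>))"
  let ?e = "\<lambda>x \<xi>::'a. exp (- (\<i> * complex_of_real (x \<bullet> \<xi>)))"
  have f [measurable]: "f \<in> borel_measurable borel"
    using cont by (rule borel_measurable_continuous_onI)
  have [measurable]: "fourier_integral f \<in> borel_measurable lebesgue"
    using int by (intro borel_measurable_fourier_integral) auto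
  have w: "integrable lebesgue ?w"
    using \<epsilon> by (rule integrable_gaussian_scaled)
  have [measurable]: "?w \<in> borel_measurable lebesgue" using w by auto
  have [measurable]: "(\<lambda>\<xi>::'a. gaussian (\<epsilon> *\<^sub>R \<xi>)) \<in> borel_measurable lebesgue"
    by (rule measurable_completion) simp
  have kernel_cnj: "cnj (?e x \<xi>) = ?e (- x) \<xi>" for x \<xi>
    by (simp add: exp_cnj)
  have [measurable]: "?e x \<in> borel_measurable lebesgue" "(\<lambda>\<xi>. ?e \<xi> x) \<in> borel_measurable lebesgue" for x
    by (rule measurable_completion, simp)+
  define g where "g \<xi> = cnj (fourier_integral f \<xi>) * ?w \<xi>" for \<xi>
  have [measurable]: "(\<lambda>\<xi>. cnj (fourier_integral f \<xi>)) \<in> borel_measurable lebesgue"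
    by (rule measurable_compose[OF _ borel_measurable_continuous_onI[OF continuous_on_cnj[OF continuous_on_id]]])
       measurable
  have g: "integrable lebesgue g"
    unfolding g_def
  proof (rule Bochner_Integration.integrable_bound[OF integrable_mult_right[OF w, of "complex_of_real ?B"]])
    show "AE \<xi> in lebesgue. norm (cnj (fourier_integral f \<xi>) * ?w \<xi>) \<le> norm (complex_of_real ?B * ?w \<xi>)"
      using norm_fourier_integral_le[of f] by (auto simp: norm_mult intro!: mult_right_mono)
  qed measurable
  have conv: "fourier_integral g x = ?c * cnj (s x)" for x
  proof -
    have k: "integrable lebesgue (\<lambda>\<xi>. ?e (- x) \<xi> * ?w \<xi>)"
      by (rule Bochner_Integration.integrable_bound[OF w]) (measurable, auto simp: norm_mult norm_fourier_kernel)
    have kf: "fourier_integral (\<lambda>\<xi>. ?e (- x) \<xi> * ?w \<xi>) y = fourier_integral ?w (y - x)" for y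
      unfolding fourier_integral_def
      by (rule Bochner_Integration.integral_cong)
         (auto simp: inner_diff_right inner_commute algebra_simps simp flip: exp_add mult.assoc)
    have "cnj (fourier_integral g x) = (LINT \<xi>|lebesgue. cnj (?e \<xi> x * g \<xi>))"
      unfolding fourier_integral_def by (rule Bochner_Integration.integral_cnj[symmetric])
    also have "\<dots> = (LINT \<xi>|lebesgue. fourier_integral f \<xi> * (?e (- x) \<xi> * ?w \<xi>))"
      by (rule Bochner_Integration.integral_cong)
         (auto simp: g_def kernel_cnj inner_commute exp_cnj mult_ac)
    also have "\<dots> = (LINT y|lebesgue. f y * fourier_integral ?w (y - x))"
      using fourier_integral_mult_formula[OF int k] unfolding kf .
    also have "\<dots> = (LINT y|lebesgue. f y * (?c * complex_of_real (gaussian ((y - x) /\<^sub>R \<epsilon>)) / complex_of_real (\<epsilon> ^ DIM('a))))"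
      using fourier_integral_gaussian_scaled[OF \<epsilon>, where 'a = 'a] \<epsilon>
      by (intro Bochner_Integration.integral_cong) (auto simp: field_simps)
    also have "\<dots> = (LINT y|lborel. f y * (?c * complex_of_real (gaussian ((y - x) /\<^sub>R \<epsilon>)) / complex_of_real (\<epsilon> ^ DIM('a))))"
      by (rule integral_completion) measurable
    also have "\<dots> = complex_of_real (\<epsilon> ^ DIM('a)) * (LINT z|lborel. f (x + \<epsilon> *\<^sub>R z) *
          (?c * complex_of_real (gaussian ((x + \<epsilon> *\<^sub>R z - x) /\<^sub>R \<epsilon>)) / complex_of_real (\<epsilon> ^ DIM('a))))"
      by (rule integral_lborel_affine) (use \<epsilon> in auto)
    also have "\<dots> = complex_of_real (\<epsilon> ^ DIM('a)) * (LINT z|lborel. (?c / complex_of_real (\<epsilon> ^ DIM('a))) *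
          (complex_of_real (gaussian z) * f (x + \<epsilon> *\<^sub>R z)))"
      using \<epsilon> by (simp add: mult_ac)
    also have "\<dots> = ?c * s x"
      using \<epsilon> unfolding s_def by simp
    finally have "cnj (cnj (fourier_integral g x)) = cnj (?c * s x)" by simp
    then show ?thesis by simp
  qed
  have fg: "fourier_integral f \<xi> * g \<xi> = complex_of_real (gaussian (\<epsilon> *\<^sub>R \<xi>) * (cmod (fourier_integral f \<xi>))\<^sup>2)" for \<xi>
    using complex_norm_square[of "fourier_integral f \<xi>"] by (simp add: g_def mult_ac)
  have "integrable lebesgue (\<lambda>\<xi>. complex_of_real ?B * g \<xi>)"
    using g by (rule integrable_mult_right)
  then have "integrable lebesgue (\<lambda>\<xi>. complex_of_real (gaussian (\<epsilon> *\<^sub>R \<xi>) * (cmod (fourier_integral f \<xi>))\<^sup>2))"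
  proof (rule Bochner_Integration.integrable_bound)
    show "AE \<xi> in lebesgue. norm (complex_of_real (gaussian (\<epsilon> *\<^sub>R \<xi>) * (cmod (fourier_integral f \<xi>))\<^sup>2))
        \<le> norm (complex_of_real ?B * g \<xi>)"
      unfolding fg[symmetric] norm_mult using norm_fourier_integral_le[of f]
      by (auto intro!: mult_right_mono)
  qed measurable
  then show "integrable lebesgue (\<lambda>\<xi>. gaussian (\<epsilon> *\<^sub>R \<xi>) * (cmod (fourier_integral f \<xi>))\<^sup>2)"
    by (simp only: complex_of_real_integrable_eq)
  have "complex_of_real (LINT \<xi>|lebesgue. gaussian (\<epsilon> *\<^sub>R \<xi>) * (cmod (fourier_integral f \<xi>))\<^sup>2)
      = (LINT \<xi>|lebesgue. fourier_integral f \<xi> * g \<xi>)"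
    unfolding fg by (rule integral_complex_of_real[symmetric])
  also have "\<dots> = (LINT x|lebesgue. f x * (?c * cnj (s x)))"
    using fourier_integral_mult_formula[OF int g] unfolding conv .
  also have "\<dots> = (LINT x|lebesgue. ?c * (f x * cnj (s x)))"
    by (simp add: mult_ac)
  also have "\<dots> = ?c * (LINT x|lebesgue. f x * cnj (s x))"
    by (rule integral_mult_right_zero)
  finally show "complex_of_real (LINT \<xi>|lebesgue. gaussian (\<epsilon> *\<^sub>R \<xi>) * (cmod (fourier_integral f \<xi>))\<^sup>2)
      = ?c * (LINT x|lebesgue. f x * cnj (s x))" .
qed

text \<open>
The integrability conditions are part of the notion because they have to be transported through the
limits below together with the identity.
\<close>

definition Plancherel :: "('a::euclidean_space \<Rightarrow> complex) \<Rightarrow> bool" where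
  "Plancherel f \<longleftrightarrow> integrable lebesgue f \<and> square_integrable f \<and>
     square_integrable (fourier_integral f) \<and>
     norm (abs_L2 (fourier_integral f)) = sqrt (2 * pi) ^ DIM('a) * norm (abs_L2 f)"

text \<open>
Let \<epsilon> tend to 0 in the regularised identity: the left-hand side converges monotonically, and the averages
s converge pointwise to a multiple of f by continuity.
\<close>

lemma Plancherel_continuous:
  fixes f :: "'a::euclidean_space \<Rightarrow> complex"
  assumes cont: "continuous_on UNIV f" and int: "integrable lebesgue f"
    and bound: "\<And>x. cmod (f x) \<le> B"
  shows "Plancherel f"
proof -
  let ?c = "sqrt (2 * pi) ^ DIM('a)"
  define e :: "nat \<Rightarrow> real" where "e k = inverse (real (Suc k))" for k
  have e: "e k > 0" for k by (simp add: e_def)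
  have e0: "e \<longlonglongrightarrow> 0" unfolding e_def by (rule LIMSEQ_inverse_real_of_nat)
  have B: "B \<ge> 0" using bound[of 0] norm_ge_zero order_trans by blast
  have f [measurable]: "f \<in> borel_measurable borel"
    using cont by (rule borel_measurable_continuous_onI)
  have [measurable]: "f \<in> borel_measurable lebesgue"
    using int by auto
  have [measurable]: "fourier_integral f \<in> borel_measurable lebesgue"
    using int by (intro borel_measurable_fourier_integral) auto
  have \<gamma>: "integrable lborel (\<lambda>x::'a. gaussian x)"
    using fourier_gaussian(1)[where 'a = 'a] by (simp only: complex_of_real_integrable_eq)
  have \<gamma>_cint: "(LINT x|lborel. complex_of_real (gaussian (x::'a))) = complex_of_real ?c"
    using fourier_gaussian(2)[of "0::'a"] by (simp add: gaussian_def[of 0])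
  then have "complex_of_real (LINT x|lborel. gaussian (x::'a)) = complex_of_real ?c"
    by (simp only: integral_complex_of_real)
  then have \<gamma>_int: "(LINT x|lborel. gaussian (x::'a)) = ?c"
    using of_real_eq_iff by blast
  define s where "s k x = (LINT z|lborel. complex_of_real (gaussian z) * f (x + e k *\<^sub>R z))" for k x
  have [measurable]: "s k \<in> borel_measurable borel" for k
    unfolding s_def by measurable
  then have [measurable]: "s k \<in> borel_measurable lebesgue" for k
    by (intro measurable_completion) simp
  have s_le: "cmod (s k x) \<le> ?c * B" for k x
  proof -
    have le: "cmod (complex_of_real (gaussian z) * f (x + e k *\<^sub>R z)) \<le> gaussian z * B" for z
      using bound less_imp_le[OF gaussian_bounds(1)[of z]] by (auto simp: norm_mult intro!: mult_left_mono)
    have \<gamma>B: "integrable lborel (\<lambda>z::'a. gaussian z * B)"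
      using \<gamma> by simp
    have "integrable lborel (\<lambda>z. complex_of_real (gaussian z) * f (x + e k *\<^sub>R z))"
      by (rule Bochner_Integration.integrable_bound[OF \<gamma>B])
         (auto intro!: order_trans[OF le abs_ge_self])
    then have "(LINT z|lborel. cmod (complex_of_real (gaussian z) * f (x + e k *\<^sub>R z))) \<le> (LINT z|lborel. gaussian (z::'a) * B)"
      by (intro integral_mono_AE integrable_norm \<gamma>B AE_I2 le)
    then have "cmod (s k x) \<le> (LINT z|lborel. gaussian (z::'a) * B)"
      unfolding s_def by (rule order_trans[OF integral_norm_bound])
    then show ?thesis by (simp add: \<gamma>_int)
  qed
  have s_lim: "(\<lambda>k. s k x) \<longlonglongrightarrow> complex_of_real ?c * f x" for x
  proof -
    have "(\<lambda>k. s k x) \<longlonglongrightarrow> (LINT z|lborel. complex_of_real (gaussian (z::'a)) * f x)"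
      unfolding s_def
    proof (rule integral_dominated_convergence[where w = "\<lambda>z. gaussian z * B"])
      show "AE z in lborel. (\<lambda>k. complex_of_real (gaussian z) * f (x + e k *\<^sub>R z)) \<longlonglongrightarrow> complex_of_real (gaussian z) * f x"
      proof (rule AE_I2)
        fix z
        have "(\<lambda>k. x + e k *\<^sub>R z) \<longlonglongrightarrow> x + 0 *\<^sub>R z"
          by (intro tendsto_intros e0)
        then have "(\<lambda>k. f (x + e k *\<^sub>R z)) \<longlonglongrightarrow> f x"
          using cont by (intro isCont_tendsto_compose[of x f]) (auto simp: continuous_on_eq_continuous_at)
        then show "(\<lambda>k. complex_of_real (gaussian z) * f (x + e k *\<^sub>R z)) \<longlonglongrightarrow> complex_of_real (gaussian z) * f x"
          by (intro tendsto_intros)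
      qed
      show "AE z in lborel. norm (complex_of_real (gaussian z) * f (x + e k *\<^sub>R z)) \<le> gaussian z * B" for k
        using bound less_imp_le[OF gaussian_bounds(1)[where 'a = 'a]] by (auto simp: norm_mult intro!: mult_left_mono)
    qed (use \<gamma> in auto)
    also have "(LINT z|lborel. complex_of_real (gaussian (z::'a)) * f x) = complex_of_real ?c * f x"
      by (simp only: integral_mult_left_zero \<gamma>_cint)
    finally show ?thesis .
  qed
  have sq: "square_integrable f"
    unfolding square_integrable_def
  proof
    show "integrable lebesgue (\<lambda>x. (cmod (f x))\<^sup>2)"
      by (rule Bochner_Integration.integrable_bound[OF integrable_mult_right[OF int, of "complex_of_real B"]])
         (auto simp: norm_mult power2_eq_square B bound intro!: mult_right_mono)
  qed simp
  have [measurable]: "(\<lambda>x. cnj (s k x)) \<in> borel_measurable lebesgue" for k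
    by (rule measurable_compose[OF _ borel_measurable_continuous_onI[OF continuous_on_cnj[OF continuous_on_id]]])
       measurable
  have "(\<lambda>k. LINT x|lebesgue. f x * cnj (s k x)) \<longlonglongrightarrow> (LINT x|lebesgue. complex_of_real (?c * (cmod (f x))\<^sup>2))"
  proof (rule integral_dominated_convergence[where w = "\<lambda>x. cmod (f x) * (?c * B)"])
    show "integrable lebesgue (\<lambda>x. cmod (f x) * (?c * B))" using int by simp
    show "AE x in lebesgue. (\<lambda>k. f x * cnj (s k x)) \<longlonglongrightarrow> complex_of_real (?c * (cmod (f x))\<^sup>2)"
    proof (rule AE_I2)
      fix x
      have "(\<lambda>k. f x * cnj (s k x)) \<longlonglongrightarrow> f x * cnj (complex_of_real ?c * f x)"
        by (intro tendsto_intros s_lim)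
      also have "f x * cnj (complex_of_real ?c * f x) = complex_of_real (?c * (cmod (f x))\<^sup>2)"
        using complex_norm_square[of "f x"] by (simp add: mult_ac)
      finally show "(\<lambda>k. f x * cnj (s k x)) \<longlonglongrightarrow> complex_of_real (?c * (cmod (f x))\<^sup>2)" .
    qed
    show "AE x in lebesgue. norm (f x * cnj (s k x)) \<le> cmod (f x) * (?c * B)" for k
      using s_le by (auto simp: norm_mult intro!: mult_left_mono)
  qed measurable
  then have "(\<lambda>k. complex_of_real ?c * (LINT x|lebesgue. f x * cnj (s k x)))
      \<longlonglongrightarrow> complex_of_real ?c * (LINT x|lebesgue. complex_of_real (?c * (cmod (f x))\<^sup>2))"
    by (intro tendsto_intros)
  also have "complex_of_real ?c * (LINT x|lebesgue. complex_of_real (?c * (cmod (f x))\<^sup>2))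
      = complex_of_real (?c\<^sup>2 * (LINT x|lebesgue. (cmod (f x))\<^sup>2))"
    unfolding integral_complex_of_real integral_mult_right_zero
    by (simp only: power2_eq_square of_real_mult mult.assoc)
  finally have "(\<lambda>k. complex_of_real (LINT \<xi>|lebesgue. gaussian (e k *\<^sub>R \<xi>) * (cmod (fourier_integral f \<xi>))\<^sup>2))
      \<longlonglongrightarrow> complex_of_real (?c\<^sup>2 * (LINT x|lebesgue. (cmod (f x))\<^sup>2))"
    unfolding regularised_Plancherel(2)[OF cont int e] s_def .
  then have lim: "(\<lambda>k. LINT \<xi>|lebesgue. gaussian (e k *\<^sub>R \<xi>) * (cmod (fourier_integral f \<xi>))\<^sup>2)
      \<longlonglongrightarrow> ?c\<^sup>2 * (LINT x|lebesgue. (cmod (f x))\<^sup>2)"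
    by (simp only: tendsto_of_real_iff)
  have mono: "AE \<xi> in lebesgue. mono (\<lambda>k. gaussian (e k *\<^sub>R \<xi>) * (cmod (fourier_integral f \<xi>))\<^sup>2)"
  proof (intro AE_I2 monoI mult_right_mono)
    fix \<xi> :: 'a and j k :: nat assume "j \<le> k"
    then have "e k * norm \<xi> \<le> e j * norm \<xi>"
      unfolding e_def by (intro mult_right_mono le_imp_inverse_le) auto
    then have "(e k * norm \<xi>)\<^sup>2 \<le> (e j * norm \<xi>)\<^sup>2"
      using e[of k] by (intro power_mono) auto
    then show "gaussian (e j *\<^sub>R \<xi>) \<le> gaussian (e k *\<^sub>R \<xi>)"
      using e[of k] e[of j] by (simp add: gaussian_def)
  qed simp
  have ptw: "AE \<xi> in lebesgue. (\<lambda>k. gaussian (e k *\<^sub>R \<xi>) * (cmod (fourier_integral f \<xi>))\<^sup>2)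
      \<longlonglongrightarrow> (cmod (fourier_integral f \<xi>))\<^sup>2"
  proof (rule AE_I2)
    fix \<xi> :: 'a
    have "(\<lambda>k. gaussian (e k *\<^sub>R \<xi>) * (cmod (fourier_integral f \<xi>))\<^sup>2)
        \<longlonglongrightarrow> exp (- (norm (0 *\<^sub>R \<xi>))\<^sup>2 / 2) * (cmod (fourier_integral f \<xi>))\<^sup>2"
      unfolding gaussian_def by (intro tendsto_intros e0) auto
    then show "(\<lambda>k. gaussian (e k *\<^sub>R \<xi>) * (cmod (fourier_integral f \<xi>))\<^sup>2)
        \<longlonglongrightarrow> (cmod (fourier_integral f \<xi>))\<^sup>2"
      by simp
  qed
  have m: "(\<lambda>\<xi>. (cmod (fourier_integral f \<xi>))\<^sup>2) \<in> borel_measurable lebesgue"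
    by measurable
  note I = regularised_Plancherel(1)[OF cont int e]
  have sq': "square_integrable (fourier_integral f)"
    using integrable_monotone_convergence[OF I mono ptw lim m] by (simp add: square_integrable_def)
  have "(LINT \<xi>|lebesgue. (cmod (fourier_integral f \<xi>))\<^sup>2) = ?c\<^sup>2 * (LINT x|lebesgue. (cmod (f x))\<^sup>2)"
    using integral_monotone_convergence[OF I mono ptw lim m] .
  then show ?thesis
    using sq sq' int by (simp add: Plancherel_def norm_abs_L2 real_sqrt_mult)
qed

section \<open>Plancherel's identity for square-integrable functions of bounded support\<close>

text \<open>
The Fourier integrals converge pointwise. Applied to differences, Plancherel's identity and Fatou's lemma
bound the distance of the transform of h k to that of f by a multiple of the distance of h k to f, so the
transforms also converge in norm.
\<close>

lemma Plancherel_dominated_limit: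
  fixes f :: "'a::euclidean_space \<Rightarrow> complex" and h :: "nat \<Rightarrow> 'a \<Rightarrow> complex"
  assumes h: "\<And>k. Plancherel (h k)" and diff: "\<And>j k. Plancherel (\<lambda>x. h j x - h k x)"
    and f: "f \<in> borel_measurable lebesgue"
    and lim: "AE x in lebesgue. (\<lambda>k. h k x) \<longlonglongrightarrow> f x"
    and g: "integrable lebesgue g" "integrable lebesgue (\<lambda>x. (g x)\<^sup>2)"
    and dom: "\<And>k x. cmod (h k x) \<le> g x"
  shows "Plancherel f"
proof -
  let ?c = "sqrt (2 * pi) ^ DIM('a)"
  have [measurable]: "f \<in> borel_measurable lebesgue" "\<And>k. h k \<in> borel_measurable lebesgue"
    "g \<in> borel_measurable lebesgue"
    using h f g by (auto simp: Plancherel_def square_integrable_def)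
  have hsq: "square_integrable (h k)" "integrable lebesgue (h k)"
    "square_integrable (fourier_integral (h k))"
    "norm (abs_L2 (fourier_integral (h k))) = ?c * norm (abs_L2 (h k))" for k
    using h by (auto simp: Plancherel_def)
  have dom_f: "AE x in lebesgue. cmod (f x) \<le> g x"
    using lim by eventually_elim (auto intro: LIMSEQ_le_const2 tendsto_norm dom)
  have int: "integrable lebesgue f"
    by (rule integrable_dominated_convergence[where w = g and s = h]) (use g lim dom in auto)
  have "integrable lebesgue (\<lambda>x. (cmod (f x))\<^sup>2)"
  proof (rule Bochner_Integration.integrable_bound[OF g(2)])
    show "AE x in lebesgue. norm ((cmod (f x))\<^sup>2) \<le> norm ((g x)\<^sup>2)"
      using dom_f by eventually_elim (simp add: power_mono)
  qed measurable
  then have sq: "square_integrable f" by (simp add: square_integrable_def)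
  have [measurable]: "fourier_integral f \<in> borel_measurable lebesgue"
    by (rule borel_measurable_fourier_integral) measurable
  have to_f: "(\<lambda>k. abs_L2 (h k)) \<longlonglongrightarrow> abs_L2 f"
  proof -
    have "(\<lambda>k. LINT x|lebesgue. (cmod (h k x - f x))\<^sup>2) \<longlonglongrightarrow> (LINT x|(lebesgue::'a measure). 0)"
    proof (rule integral_dominated_convergence[where w = "\<lambda>x. (2 * g x)\<^sup>2"])
      show "integrable lebesgue (\<lambda>x. (2 * g x)\<^sup>2)" using g(2) by (simp add: power_mult_distrib)
      show "AE x in lebesgue. (\<lambda>k. (cmod (h k x - f x))\<^sup>2) \<longlonglongrightarrow> 0"
        using lim
      proof eventually_elim
        fix x assume "(\<lambda>k. h k x) \<longlonglongrightarrow> f x"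
        then have "(\<lambda>k. (cmod (h k x - f x))\<^sup>2) \<longlonglongrightarrow> (cmod (f x - f x))\<^sup>2"
          by (intro tendsto_intros)
        then show "(\<lambda>k. (cmod (h k x - f x))\<^sup>2) \<longlonglongrightarrow> 0" by simp
      qed
      show "AE x in lebesgue. norm ((cmod (h k x - f x))\<^sup>2) \<le> (2 * g x)\<^sup>2" for k
        using dom_f
      proof eventually_elim
        fix x assume "cmod (f x) \<le> g x"
        then have "cmod (h k x - f x) \<le> 2 * g x"
          using norm_triangle_ineq4[of "h k x" "f x"] dom[of k x] by linarith
        then show "norm ((cmod (h k x - f x))\<^sup>2) \<le> (2 * g x)\<^sup>2"
          using power_mono[of "cmod (h k x - f x)" "2 * g x" 2] by simp
      qed
    qed measurable
    then have "(\<lambda>k. (norm (abs_L2 (h k) - abs_L2 f))\<^sup>2) \<longlonglongrightarrow> 0"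
      by (simp add: abs_L2_diff hsq sq power2_norm_abs_L2 square_integrable_diff)
    then show ?thesis
      by (simp add: LIM_zero_iff tendsto_norm_zero_iff)
  qed
  have ptw: "(\<lambda>k. fourier_integral (h k) \<xi>) \<longlonglongrightarrow> fourier_integral f \<xi>" for \<xi>
    unfolding fourier_integral_def
  proof (rule integral_dominated_convergence[where w = g])
    show "AE x in lebesgue. (\<lambda>k. exp (- (\<i> * complex_of_real (x \<bullet> \<xi>))) * h k x)
        \<longlonglongrightarrow> exp (- (\<i> * complex_of_real (x \<bullet> \<xi>))) * f x"
      using lim by eventually_elim (intro tendsto_intros)
    show "AE x in lebesgue. norm (exp (- (\<i> * complex_of_real (x \<bullet> \<xi>))) * h k x) \<le> g x" for k
      using dom by (simp add: norm_mult norm_fourier_kernel)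
  qed (use g integrable_fourier_kernel_mult[OF int] integrable_fourier_kernel_mult[OF hsq(2)] in auto)
  have bound: "square_integrable (\<lambda>\<xi>. fourier_integral (h k) \<xi> - fourier_integral f \<xi>)"
    "norm (abs_L2 (\<lambda>\<xi>. fourier_integral (h k) \<xi> - fourier_integral f \<xi>)) \<le> C"
    if C: "C > ?c * norm (abs_L2 (h k) - abs_L2 f)" for k C
  proof -
    have F: "fourier_integral (\<lambda>x. h k x - h j x) = (\<lambda>\<xi>. fourier_integral (h k) \<xi> - fourier_integral (h j) \<xi>)" for j
      by (rule ext, rule fourier_integral_diff) (rule hsq)+
    have "norm (abs_L2 (\<lambda>\<xi>. fourier_integral (h k) \<xi> - fourier_integral (h j) \<xi>))
        = ?c * norm (abs_L2 (h k) - abs_L2 (h j))" for j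
      using diff[of k j] by (simp add: Plancherel_def F abs_L2_diff hsq)
    moreover have "(\<lambda>j. ?c * norm (abs_L2 (h k) - abs_L2 (h j))) \<longlonglongrightarrow> ?c * norm (abs_L2 (h k) - abs_L2 f)"
      by (intro tendsto_intros to_f)
    then have "eventually (\<lambda>j. ?c * norm (abs_L2 (h k) - abs_L2 (h j)) < C) sequentially"
      using C by (rule order_tendstoD)
    ultimately have ev: "eventually (\<lambda>j. norm (abs_L2 (\<lambda>\<xi>. fourier_integral (h k) \<xi> - fourier_integral (h j) \<xi>)) \<le> C) sequentially"
      by (auto elim: eventually_mono)
    have lim': "AE \<xi> in lebesgue. (\<lambda>j. fourier_integral (h k) \<xi> - fourier_integral (h j) \<xi>)
        \<longlonglongrightarrow> fourier_integral (h k) \<xi> - fourier_integral f \<xi>"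
      by (intro AE_I2 tendsto_intros ptw)
    have m: "(\<lambda>\<xi>. fourier_integral (h k) \<xi> - fourier_integral f \<xi>) \<in> borel_measurable lebesgue"
      using hsq(3)[of k] by (auto simp: square_integrable_def)
    show "square_integrable (\<lambda>\<xi>. fourier_integral (h k) \<xi> - fourier_integral f \<xi>)"
      "norm (abs_L2 (\<lambda>\<xi>. fourier_integral (h k) \<xi> - fourier_integral f \<xi>)) \<le> C"
      using square_integrable_Fatou[OF _ m lim' ev] hsq(3) by (auto intro: square_integrable_diff)
  qed
  have sqF: "square_integrable (fourier_integral f)"
    using square_integrable_diff[OF hsq(3)[of 0] bound(1)[of 0 "?c * norm (abs_L2 (h 0) - abs_L2 f) + 1"]]
    by simp
  have le: "norm (abs_L2 (fourier_integral (h k)) - abs_L2 (fourier_integral f)) \<le> ?c * norm (abs_L2 (h k) - abs_L2 f)" for k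
  proof (rule dense_ge)
    fix C assume "C > ?c * norm (abs_L2 (h k) - abs_L2 f)"
    from bound(2)[OF this]
    show "norm (abs_L2 (fourier_integral (h k)) - abs_L2 (fourier_integral f)) \<le> C"
      by (simp only: abs_L2_diff[OF hsq(3) sqF])
  qed
  have "(\<lambda>k. abs_L2 (fourier_integral (h k)) - abs_L2 (fourier_integral f)) \<longlonglongrightarrow> 0"
  proof (rule Lim_null_comparison)
    show "eventually (\<lambda>k. norm (abs_L2 (fourier_integral (h k)) - abs_L2 (fourier_integral f))
        \<le> ?c * norm (abs_L2 (h k) - abs_L2 f)) sequentially"
      using le by simp
    have "(\<lambda>k. ?c * norm (abs_L2 (h k) - abs_L2 f)) \<longlonglongrightarrow> ?c * norm (abs_L2 f - abs_L2 f)"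
      by (intro tendsto_intros to_f)
    then show "(\<lambda>k. ?c * norm (abs_L2 (h k) - abs_L2 f)) \<longlonglongrightarrow> 0" by simp
  qed
  then have "(\<lambda>k. abs_L2 (fourier_integral (h k))) \<longlonglongrightarrow> abs_L2 (fourier_integral f)"
    by (simp add: LIM_zero_iff)
  then have "(\<lambda>k. norm (abs_L2 (fourier_integral (h k)))) \<longlonglongrightarrow> norm (abs_L2 (fourier_integral f))"
    by (rule tendsto_norm)
  moreover have "(\<lambda>k. norm (abs_L2 (fourier_integral (h k)))) \<longlonglongrightarrow> ?c * norm (abs_L2 f)"
    unfolding hsq(4) by (intro tendsto_intros to_f)
  ultimately have "norm (abs_L2 (fourier_integral f)) = ?c * norm (abs_L2 f)"
    by (rule LIMSEQ_unique)
  then show ?thesis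
    using int sq sqF by (simp add: Plancherel_def)
qed

text \<open>
The radial retraction onto the ball of radius B. It makes the continuous approximations below uniformly
bounded without changing their limit.
\<close>

definition clamp_norm :: "real \<Rightarrow> complex \<Rightarrow> complex" where
  "clamp_norm B z = complex_of_real (B / max B (cmod z)) * z"

lemma norm_clamp_norm_le:
  assumes "B > 0" shows "cmod (clamp_norm B z) \<le> B"
  using assms by (auto simp: clamp_norm_def norm_mult norm_divide max_def field_simps)

lemma clamp_norm_id: "B > 0 \<Longrightarrow> cmod z \<le> B \<Longrightarrow> clamp_norm B z = z"
  by (simp add: clamp_norm_def)

lemma continuous_clamp_norm:
  assumes "B > 0" shows "continuous_on UNIV (clamp_norm B)"
  unfolding clamp_norm_def using assms by (intro continuous_intros) (auto simp: max_def)

lemma integrable_indicator_cball: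
  "integrable lebesgue (\<lambda>x::'a::euclidean_space. c * indicator (cball 0 R) x :: real)"
  using emeasure_lborel_cball_finite[of "0::'a" R] by (intro integrable_mult_right) (simp add: integrable_indicator_iff less_top)

text \<open>
A measurable function is almost everywhere a limit of continuous functions. Clamping their values and
multiplying by a cut-off function makes them dominated by a multiple of the indicator of a ball.
\<close>

lemma Plancherel_bounded:
  fixes f :: "'a::euclidean_space \<Rightarrow> complex"
  assumes f: "f \<in> borel_measurable lebesgue"
    and bound: "\<And>x. cmod (f x) \<le> B" and supp: "\<And>x. norm x > R \<Longrightarrow> f x = 0"
  shows "Plancherel f"
proof -
  define B' where "B' = max B 1"
  have B': "B' > 0" "\<And>x. cmod (f x) \<le> B'"
    using bound by (auto simp: B'_def intro: order_trans max.cobounded1)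
  have "f measurable_on UNIV"
    using f by (simp add: measurable_on_iff_borel_measurable)
  then obtain N g where N: "negligible N" and g: "\<And>n. continuous_on UNIV (g n)"
    and glim: "\<And>x. x \<notin> N \<Longrightarrow> (\<lambda>n. g n x) \<longlonglongrightarrow> f x"
    unfolding measurable_on_def by auto
  define cut :: "'a \<Rightarrow> real" where "cut x = max 0 (min 1 (R + 1 - norm x))" for x
  have cut: "0 \<le> cut x" "cut x \<le> 1" "norm x \<le> R \<Longrightarrow> cut x = 1" "norm x > R + 1 \<Longrightarrow> cut x = 0" for x
    by (auto simp: cut_def)
  have cut_cont: "continuous_on UNIV cut"
    unfolding cut_def by (intro continuous_intros)
  define h where "h k x = complex_of_real (cut x) * clamp_norm B' (g k x)" for k x
  define w where "w x = B' * indicator (cball 0 (R + 1)) x" for x :: 'a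
  have h_le: "cmod (h k x) \<le> w x" for k x
  proof (cases "norm x \<le> R + 1")
    case True
    have "cut x * cmod (clamp_norm B' (g k x)) \<le> 1 * B'"
      using cut B' by (intro mult_mono norm_clamp_norm_le) auto
    then show ?thesis using True cut(1)[of x] by (simp add: h_def w_def norm_mult)
  qed (use cut(4)[of x] in \<open>simp add: h_def w_def\<close>)
  have w_le: "w x \<le> B'" for x
    using B' by (simp add: w_def indicator_def)
  have h_cont: "continuous_on UNIV (h k)" for k
    unfolding h_def
    by (intro continuous_intros continuous_on_of_real cut_cont
        continuous_on_compose2[OF continuous_clamp_norm[OF B'(1)] g]) auto
  have w: "integrable lebesgue w" "integrable lebesgue (\<lambda>x. (w x)\<^sup>2)"
  proof -
    show "integrable lebesgue w" unfolding w_def by (rule integrable_indicator_cball)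
    have "(w x)\<^sup>2 = B'\<^sup>2 * indicator (cball 0 (R + 1)) x" for x
      by (simp add: w_def power_mult_distrib indicator_def)
    then show "integrable lebesgue (\<lambda>x. (w x)\<^sup>2)"
      using integrable_indicator_cball[where 'a = 'a] by simp
  qed
  have h_meas: "h k \<in> borel_measurable lebesgue" for k
    using borel_measurable_continuous_onI[OF h_cont[of k]] by (intro measurable_completion) simp
  have h_int: "integrable lebesgue (h k)" for k
  proof (rule Bochner_Integration.integrable_bound[OF w(1) h_meas])
    show "AE x in lebesgue. norm (h k x) \<le> norm (w x)"
      unfolding real_norm_def by (intro AE_I2 order_trans[OF h_le abs_ge_self])
  qed
  show ?thesis
  proof (rule Plancherel_dominated_limit[OF _ _ f _ w h_le])
    show "Plancherel (h k)" for k
      using h_le w_le by (intro Plancherel_continuous[of _ B'] h_cont h_int) (blast intro: order_trans)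
    show "Plancherel (\<lambda>x. h j x - h k x)" for j k
    proof (rule Plancherel_continuous[of _ "B' + B'"])
      show "cmod (h j x - h k x) \<le> B' + B'" for x
        using norm_triangle_ineq4[of "h j x" "h k x"] h_le[of j x] h_le[of k x] w_le[of x] by linarith
    qed (intro continuous_intros h_cont Bochner_Integration.integrable_diff h_int)+
    have "AE x in lebesgue. x \<notin> N"
      using N by (simp add: AE_not_in negligible_iff_null_sets)
    then show "AE x in lebesgue. (\<lambda>k. h k x) \<longlonglongrightarrow> f x"
    proof eventually_elim
      fix x assume "x \<notin> N"
      then have "(\<lambda>k. clamp_norm B' (g k x)) \<longlonglongrightarrow> clamp_norm B' (f x)"
        using continuous_clamp_norm[OF B'(1)] glim
        by (intro isCont_tendsto_compose[of _ "clamp_norm B'"]) (auto simp: continuous_on_eq_continuous_at)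
      then have "(\<lambda>k. h k x) \<longlonglongrightarrow> complex_of_real (cut x) * f x"
        unfolding h_def using B' by (simp add: clamp_norm_id tendsto_mult_left)
      moreover have "complex_of_real (cut x) * f x = f x"
        using cut(3)[of x] supp[of x] by (cases "norm x \<le> R") auto
      ultimately show "(\<lambda>k. h k x) \<longlonglongrightarrow> f x" by simp
    qed
  qed
qed

lemma integrable_square_integrable_bounded_support:
  fixes f :: "'a::euclidean_space \<Rightarrow> complex"
  assumes f: "square_integrable f" and supp: "\<And>x. norm x > R \<Longrightarrow> f x = 0"
  shows "integrable lebesgue f"
proof -
  define w where "w x = (cmod (f x))\<^sup>2 + indicator (cball 0 R) x" for x
  have "integrable lebesgue (\<lambda>x. (cmod (f x))\<^sup>2)"
    using f by (simp add: square_integrable_def)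
  moreover have "integrable lebesgue (\<lambda>x::'a. indicator (cball 0 R) x :: real)"
    using integrable_indicator_cball[of 1 R, where 'a = 'a] by simp
  ultimately have w: "integrable lebesgue w"
    unfolding w_def by (rule Bochner_Integration.integrable_add)
  have le: "cmod (f x) \<le> w x" for x
  proof (cases "norm x \<le> R")
    case True
    have "2 * cmod (f x) * 1 \<le> (cmod (f x))\<^sup>2 + 1\<^sup>2" by (rule sum_squares_bound)
    then have "cmod (f x) \<le> (cmod (f x))\<^sup>2 + 1"
      using norm_ge_zero[of "f x"] unfolding power_one mult_1_right by linarith
    then show ?thesis using True by (simp add: w_def)
  qed (use supp in \<open>simp add: w_def\<close>)
  show ?thesis
  proof (rule Bochner_Integration.integrable_bound[OF w])
    show "AE x in lebesgue. norm (f x) \<le> norm (w x)"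
      unfolding real_norm_def by (intro AE_I2 order_trans[OF le abs_ge_self])
  qed (use f in \<open>simp add: square_integrable_def\<close>)
qed

text \<open>
Values of modulus larger than k are replaced by 0, and k tends to infinity; f itself is the dominating
function. It is integrable because its support is bounded.
\<close>

lemma Plancherel_bounded_support:
  fixes f :: "'a::euclidean_space \<Rightarrow> complex"
  assumes f: "square_integrable f" and supp: "\<And>x. norm x > R \<Longrightarrow> f x = 0"
  shows "Plancherel f"
proof -
  have [measurable]: "f \<in> borel_measurable lebesgue" using f by (simp add: square_integrable_def)
  define h where "h k x = (if cmod (f x) \<le> real k then f x else 0)" for k x
  have [measurable]: "h k \<in> borel_measurable lebesgue" for k
    unfolding h_def by measurable
  have h_le: "cmod (h k x) \<le> real k" for k x by (simp add: h_def)
  show ?thesis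
  proof (rule Plancherel_dominated_limit[where h = h and g = "\<lambda>x. cmod (f x)"])
    show "Plancherel (h k)" for k
      by (rule Plancherel_bounded[of _ "real k" R]) (auto simp: h_def supp)
    show "Plancherel (\<lambda>x. h j x - h k x)" for j k
    proof (rule Plancherel_bounded[of _ "real j + real k" R])
      show "cmod (h j x - h k x) \<le> real j + real k" for x
        using norm_triangle_ineq4[of "h j x" "h k x"] h_le[of j x] h_le[of k x] by linarith
    qed (auto simp: h_def supp)
    show "AE x in lebesgue. (\<lambda>k. h k x) \<longlonglongrightarrow> f x"
    proof (rule AE_I2, rule tendsto_eventually)
      fix x
      obtain K where "cmod (f x) \<le> real K" using real_arch_simple by blast
      then have "h k x = f x" if "k \<ge> K" for k using that by (simp add: h_def)
      then show "eventually (\<lambda>k. h k x = f x) sequentially"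
        using eventually_sequentially by blast
    qed
    show "integrable lebesgue (\<lambda>x. cmod (f x))"
      using integrable_square_integrable_bounded_support[OF f supp] by auto
    show "integrable lebesgue (\<lambda>x. (cmod (f x))\<^sup>2)"
      using f by (simp add: square_integrable_def)
  qed (auto simp: h_def)
qed

section \<open>The Fourier-Plancherel transform\<close>

abbreviation truncation :: "real \<Rightarrow> 'a::euclidean_space L2 \<Rightarrow> 'a \<Rightarrow> complex" where
  "truncation R u \<equiv> \<lambda>x. indicator (cball 0 R) x * rep_L2 u x"

lemma fourier_trunc_eq: "fourier_trunc R (rep_L2 u) = fourier_integral (truncation R u)"
  by (rule ext) (simp add: fourier_trunc_def fourier_integral_def mult_ac)

lemma square_integrable_truncation: "square_integrable (truncation R u)"
  by (intro square_integrable_indicator_mult square_integrable_rep_L2) simp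

lemma integrable_truncation: "integrable lebesgue (truncation R u)"
  by (rule integrable_square_integrable_bounded_support[OF square_integrable_truncation, of R]) simp

lemma square_integrable_fourier_trunc: "square_integrable (fourier_trunc R (rep_L2 u))"
  unfolding fourier_trunc_eq
  using Plancherel_bounded_support[OF square_integrable_truncation, of R R u] by (simp add: Plancherel_def)

lemma fourier_trunc_isometry:
  fixes u :: "'a::euclidean_space L2"
  shows "norm (abs_L2 (fourier_trunc R (rep_L2 u)) - abs_L2 (fourier_trunc S (rep_L2 u)))
    = sqrt (2 * pi) ^ DIM('a) * norm (mult_indicator (cball 0 R) u - mult_indicator (cball 0 S) u)"
proof -
  have "Plancherel (\<lambda>x. truncation R u x - truncation S u x)"
    by (rule Plancherel_bounded_support[where R = "max R S"])
       (intro square_integrable_diff square_integrable_truncation, simp)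
  moreover have "fourier_integral (\<lambda>x. truncation R u x - truncation S u x)
      = (\<lambda>\<xi>. fourier_trunc R (rep_L2 u) \<xi> - fourier_trunc S (rep_L2 u) \<xi>)"
    unfolding fourier_trunc_eq by (rule ext, rule fourier_integral_diff) (rule integrable_truncation)+
  ultimately show ?thesis
    by (simp add: Plancherel_def mult_indicator_def abs_L2_diff square_integrable_truncation
        square_integrable_fourier_trunc)
qed

lemma norm_fourier_trunc:
  fixes u :: "'a::euclidean_space L2"
  shows "norm (abs_L2 (fourier_trunc R (rep_L2 u)))
    = sqrt (2 * pi) ^ DIM('a) * norm (mult_indicator (cball 0 R) u)"
  using Plancherel_bounded_support[OF square_integrable_truncation, of R R u]
  by (simp add: Plancherel_def mult_indicator_def fourier_trunc_eq)

lemma mult_indicator_cball_tendsto: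
  "((\<lambda>R. mult_indicator (cball 0 R) u) \<longlongrightarrow> (u :: 'a::euclidean_space L2)) at_top"
proof -
  have [measurable]: "rep_L2 u \<in> borel_measurable lebesgue"
    using square_integrable_rep_L2[of u] by (simp add: square_integrable_def)
  have "((\<lambda>R. LINT x|lebesgue. (cmod (truncation R u x - rep_L2 u x))\<^sup>2) \<longlongrightarrow> (LINT x|(lebesgue::'a measure). 0)) at_top"
  proof (rule integral_dominated_convergence_at_top[where w = "\<lambda>x. (cmod (rep_L2 u x))\<^sup>2"])
    show "integrable lebesgue (\<lambda>x. (cmod (rep_L2 u x))\<^sup>2)"
      using square_integrable_rep_L2[of u] by (simp add: square_integrable_def)
    show "AE x in lebesgue. ((\<lambda>R. (cmod (truncation R u x - rep_L2 u x))\<^sup>2) \<longlongrightarrow> 0) at_top"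
    proof (rule AE_I2, rule tendsto_eventually)
      fix x
      show "eventually (\<lambda>R. (cmod (truncation R u x - rep_L2 u x))\<^sup>2 = 0) at_top"
        using eventually_ge_at_top[of "norm x"] by eventually_elim simp
    qed
    show "eventually (\<lambda>R. AE x in lebesgue. norm ((cmod (truncation R u x - rep_L2 u x))\<^sup>2) \<le> (cmod (rep_L2 u x))\<^sup>2) at_top"
      by (auto simp: indicator_def)
    show "(\<lambda>x. (cmod (truncation R u x - rep_L2 u x))\<^sup>2) \<in> borel_measurable lebesgue" for R
      using square_integrable_truncation[of R u] by (auto simp: square_integrable_def)
  qed auto
  also have "(\<lambda>R. LINT x|lebesgue. (cmod (truncation R u x - rep_L2 u x))\<^sup>2)
      = (\<lambda>R. (norm (mult_indicator (cball 0 R) u - u))\<^sup>2)"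
    using abs_L2_diff[OF square_integrable_truncation square_integrable_rep_L2, of _ u u]
      power2_norm_abs_L2[OF square_integrable_diff[OF square_integrable_truncation square_integrable_rep_L2], of _ u u]
    by (simp add: mult_indicator_def abs_rep_L2)
  finally show ?thesis
    by (simp add: LIM_zero_iff tendsto_norm_zero_iff)
qed

text \<open>
By the isometry the truncated transforms are Cauchy because the truncations of u are. The limit along
integer radii is the limit along all radii, since its distance to the transform of radius R is
a multiple of the distance of u to its truncation.
\<close>

lemma fourier_trunc_convergent:
  fixes u :: "'a::euclidean_space L2"
  shows "\<exists>g. ((\<lambda>R. abs_L2 (fourier_trunc R (rep_L2 u))) \<longlongrightarrow> g) at_top"
proof -
  let ?c = "sqrt (2 * pi) ^ DIM('a)"
  let ?T = "\<lambda>R. abs_L2 (fourier_trunc R (rep_L2 u))"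
  let ?P = "\<lambda>R. mult_indicator (cball 0 R) u"
  have P: "(\<lambda>n. ?P (real n)) \<longlonglongrightarrow> u"
    by (rule filterlim_compose[OF mult_indicator_cball_tendsto filterlim_real_sequentially])
  have "Cauchy (\<lambda>n. ?T (real n))"
    unfolding Cauchy_iff
  proof (intro allI impI)
    fix e :: real assume "e > 0"
    then have "e / ?c > 0" by simp
    then obtain M where "\<forall>m\<ge>M. \<forall>n\<ge>M. norm (?P (real m) - ?P (real n)) < e / ?c"
      using LIMSEQ_imp_Cauchy[OF P] unfolding Cauchy_iff by blast
    then show "\<exists>M. \<forall>m\<ge>M. \<forall>n\<ge>M. norm (?T (real m) - ?T (real n)) < e"
      unfolding fourier_trunc_isometry by (auto simp: field_simps)
  qed
  then obtain g where g: "(\<lambda>n. ?T (real n)) \<longlonglongrightarrow> g"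
    using Cauchy_convergent convergent_def by blast
  have eq: "norm (?T R - g) = ?c * norm (?P R - u)" for R
  proof (rule LIMSEQ_unique)
    show "(\<lambda>n. norm (?T R - ?T (real n))) \<longlonglongrightarrow> norm (?T R - g)"
      by (intro tendsto_intros g)
    show "(\<lambda>n. norm (?T R - ?T (real n))) \<longlonglongrightarrow> ?c * norm (?P R - u)"
      unfolding fourier_trunc_isometry by (intro tendsto_intros P)
  qed
  have "((\<lambda>R. ?c * norm (?P R - u)) \<longlongrightarrow> ?c * norm (u - u)) at_top"
    by (intro tendsto_intros mult_indicator_cball_tendsto)
  then have "((\<lambda>R. norm (?T R - g)) \<longlongrightarrow> 0) at_top"
    unfolding eq by simp
  then have "(?T \<longlongrightarrow> g) at_top"
    by (simp add: LIM_zero_iff tendsto_norm_zero_iff)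
  then show ?thesis by blast
qed

lemma fourier_L2_eqI:
  assumes "((\<lambda>R. abs_L2 (fourier_trunc R (rep_L2 u))) \<longlongrightarrow> g) at_top"
  shows "fourier_L2 u = g"
proof -
  let ?T = "\<lambda>R. abs_L2 (fourier_trunc R (rep_L2 u))"
  have "((\<lambda>R. \<integral>\<^sup>+\<xi>. ennreal ((cmod (fourier_trunc R (rep_L2 u) \<xi> - rep_L2 g \<xi>))\<^sup>2) \<partial>lebesgue) \<longlongrightarrow> 0) at_top
      \<longleftrightarrow> (?T \<longlongrightarrow> g) at_top" for g
  proof -
    have "?T R - g = abs_L2 (\<lambda>\<xi>. fourier_trunc R (rep_L2 u) \<xi> - rep_L2 g \<xi>)" for R
      using abs_L2_diff[OF square_integrable_fourier_trunc square_integrable_rep_L2, of R u g]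
      by (simp add: abs_rep_L2)
    then have "(\<integral>\<^sup>+\<xi>. ennreal ((cmod (fourier_trunc R (rep_L2 u) \<xi> - rep_L2 g \<xi>))\<^sup>2) \<partial>lebesgue)
        = ennreal ((norm (?T R - g))\<^sup>2)" for R
      using nn_integral_square_integrable[OF square_integrable_diff[OF square_integrable_fourier_trunc square_integrable_rep_L2], of R u g]
      by simp
    then have "((\<lambda>R. \<integral>\<^sup>+\<xi>. ennreal ((cmod (fourier_trunc R (rep_L2 u) \<xi> - rep_L2 g \<xi>))\<^sup>2) \<partial>lebesgue) \<longlongrightarrow> 0) at_top
        \<longleftrightarrow> ((\<lambda>R. ennreal ((norm (?T R - g))\<^sup>2)) \<longlongrightarrow> ennreal 0) at_top"
      by simp
    also have "\<dots> \<longleftrightarrow> ((\<lambda>R. (norm (?T R - g))\<^sup>2) \<longlongrightarrow> 0) at_top"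
      by (rule tendsto_ennreal_iff) auto
    also have "\<dots> \<longleftrightarrow> (?T \<longlongrightarrow> g) at_top"
      by (simp add: LIM_zero_iff tendsto_norm_zero_iff)
    finally show ?thesis .
  qed
  then have "fourier_L2 u = (THE g. (?T \<longlongrightarrow> g) at_top)"
    by (simp add: fourier_L2_def)
  also have "\<dots> = g"
  proof (rule the_equality)
    show "g' = g" if "(?T \<longlongrightarrow> g') at_top" for g'
      using that assms by (rule tendsto_unique[rotated]) simp
  qed (rule assms)
  finally show ?thesis .
qed

lemma fourier_L2_tendsto:
  "((\<lambda>R. abs_L2 (fourier_trunc R (rep_L2 u))) \<longlongrightarrow> fourier_L2 u) at_top"
  using fourier_trunc_convergent[of u] fourier_L2_eqI[of u] by auto

lemma norm_fourier_L2:
  fixes u :: "'a::euclidean_space L2"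
  shows "norm (fourier_L2 u) = sqrt (2 * pi) ^ DIM('a) * norm u"
proof (rule tendsto_unique)
  show "((\<lambda>R. norm (abs_L2 (fourier_trunc R (rep_L2 u)))) \<longlongrightarrow> norm (fourier_L2 u)) at_top"
    by (intro tendsto_intros fourier_L2_tendsto)
  show "((\<lambda>R. norm (abs_L2 (fourier_trunc R (rep_L2 u)))) \<longlongrightarrow> sqrt (2 * pi) ^ DIM('a) * norm u) at_top"
    unfolding norm_fourier_trunc by (intro tendsto_intros mult_indicator_cball_tendsto)
qed simp

lemma fourier_L2_add: "fourier_L2 (u + v) = fourier_L2 u + fourier_L2 (v :: 'a::euclidean_space L2)"
proof (rule fourier_L2_eqI)
  have rep: "AE x in lebesgue. rep_L2 (u + v) x = rep_L2 u x + rep_L2 v x"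
    using rep_abs_L2[OF square_integrable_add[OF square_integrable_rep_L2 square_integrable_rep_L2], of u v]
      abs_L2_add[OF square_integrable_rep_L2 square_integrable_rep_L2, of u v]
    by (simp only: abs_rep_L2)
  have "abs_L2 (fourier_trunc R (rep_L2 (u + v))) = abs_L2 (fourier_trunc R (rep_L2 u)) + abs_L2 (fourier_trunc R (rep_L2 v))"
    for R
  proof -
    have "fourier_trunc R (rep_L2 (u + v)) = fourier_integral (\<lambda>x. truncation R u x + truncation R v x)"
      unfolding fourier_trunc_eq
    proof (rule fourier_integral_cong_AE)
      show "AE x in lebesgue. truncation R (u + v) x = truncation R u x + truncation R v x"
        using rep by eventually_elim (simp add: distrib_left)
    qed (use square_integrable_truncation[of R "u + v"]
        square_integrable_add[OF square_integrable_truncation square_integrable_truncation, of R u R v]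
        in \<open>auto simp: square_integrable_def\<close>)
    also have "\<dots> = (\<lambda>\<xi>. fourier_trunc R (rep_L2 u) \<xi> + fourier_trunc R (rep_L2 v) \<xi>)"
      unfolding fourier_trunc_eq by (rule ext, rule fourier_integral_add) (rule integrable_truncation)+
    finally show ?thesis
      by (simp add: abs_L2_add square_integrable_fourier_trunc)
  qed
  then show "((\<lambda>R. abs_L2 (fourier_trunc R (rep_L2 (u + v)))) \<longlongrightarrow> fourier_L2 u + fourier_L2 v) at_top"
    by (simp add: tendsto_add fourier_L2_tendsto)
qed

lemma inner_fourier_L2:
  fixes u v :: "'a::euclidean_space L2"
  shows "fourier_L2 u \<bullet> fourier_L2 v = (2 * pi) ^ DIM('a) * (u \<bullet> v)"
proof -
  have pol: "x \<bullet> y = ((norm (x + y))\<^sup>2 - (norm x)\<^sup>2 - (norm y)\<^sup>2) / 2" for x y :: "'a L2"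
    by (simp add: power2_norm_eq_inner inner_add inner_commute)
  have "(sqrt (2 * pi) ^ DIM('a))\<^sup>2 = ((sqrt (2 * pi))\<^sup>2) ^ DIM('a)"
    by (simp only: power_mult[symmetric] mult.commute)
  also have "(sqrt (2 * pi))\<^sup>2 = 2 * pi"
    by simp
  finally show ?thesis
    unfolding pol[of "fourier_L2 u"] pol[of u] fourier_L2_add[symmetric] norm_fourier_L2 power_mult_distrib
    by (simp add: algebra_simps)
qed

lemma fourier_L2_diff: "fourier_L2 (u - v) = fourier_L2 u - fourier_L2 (v :: 'a::euclidean_space L2)"
  using fourier_L2_add[of "u - v" v] by (simp add: algebra_simps)

lemma fourier_L2_abs_L2:
  assumes f: "square_integrable f" and supp: "\<And>x. norm x > R \<Longrightarrow> f x = 0"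
  shows "fourier_L2 (abs_L2 f) = abs_L2 (fourier_integral f)"
proof (rule fourier_L2_eqI, rule tendsto_eventually)
  show "eventually (\<lambda>S. abs_L2 (fourier_trunc S (rep_L2 (abs_L2 f))) = abs_L2 (fourier_integral f)) at_top"
    using eventually_ge_at_top[of R]
  proof eventually_elim
    fix S assume S: "S \<ge> R"
    have "fourier_trunc S (rep_L2 (abs_L2 f)) = fourier_integral f"
      unfolding fourier_trunc_eq
    proof (rule fourier_integral_cong_AE)
      show "AE x in lebesgue. truncation S (abs_L2 f) x = f x"
        using rep_abs_L2[OF f]
        by eventually_elim (use supp S in \<open>auto simp: indicator_def\<close>)
    qed (use f square_integrable_truncation in \<open>auto simp: square_integrable_def\<close>)
    then show "abs_L2 (fourier_trunc S (rep_L2 (abs_L2 f))) = abs_L2 (fourier_integral f)" by simp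
  qed
qed

section \<open>Surjectivity\<close>

lemma square_integrable_cnj:
  assumes "square_integrable f" shows "square_integrable (\<lambda>x. cnj (f x))"
proof -
  have "(\<lambda>x. cnj (f x)) \<in> borel_measurable lebesgue"
    using assms
    by (intro measurable_compose[OF _ borel_measurable_continuous_onI[OF continuous_on_cnj[OF continuous_on_id]]])
       (simp add: square_integrable_def)
  then show ?thesis using assms by (simp add: square_integrable_def)
qed

lift_definition cnj_L2 :: "'a::euclidean_space L2 \<Rightarrow> 'a L2" is "\<lambda>f x. cnj (f x)"
  by (auto simp: L2_rel_def square_integrable_cnj)

lemma cnj_L2_abs: "square_integrable f \<Longrightarrow> cnj_L2 (abs_L2 f) = abs_L2 (\<lambda>x. cnj (f x))"
  by (simp add: cnj_L2.abs_eq L2_rel_refl)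

lemma cnj_L2_cnj_L2 [simp]: "cnj_L2 (cnj_L2 u) = u"
  by transfer (simp add: L2_rel_def)

lemma cnj_L2_diff: "cnj_L2 (u - v) = cnj_L2 u - cnj_L2 v"
  by transfer (auto simp: L2_rel_def square_integrable_cnj square_integrable_diff)

lemma norm_cnj_L2 [simp]: "norm (cnj_L2 u) = norm u"
  by transfer simp

lemma tendsto_cnj_L2:
  assumes "(X \<longlongrightarrow> u) F" shows "((\<lambda>i. cnj_L2 (X i)) \<longlongrightarrow> cnj_L2 u) F"
proof -
  have "((\<lambda>i. norm (X i - u)) \<longlongrightarrow> 0) F"
    using assms by (simp add: LIM_zero_iff tendsto_norm_zero_iff)
  then have "((\<lambda>i. norm (cnj_L2 (X i) - cnj_L2 u)) \<longlongrightarrow> 0) F"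
    by (simp flip: cnj_L2_diff)
  then show ?thesis by (simp add: LIM_zero_iff tendsto_norm_zero_iff)
qed

text \<open>
The multiplication formula, extended from truncations to the whole space by continuity. The conjugation
turns the Hermitian scalar product into a bilinear pairing.
\<close>

lemma fourier_L2_transpose:
  fixes u v :: "'a::euclidean_space L2"
  shows "fourier_L2 u \<bullet> cnj_L2 v = u \<bullet> cnj_L2 (fourier_L2 v)"
proof (rule tendsto_unique)
  let ?T = "\<lambda>R u. abs_L2 (fourier_trunc R (rep_L2 u))" and ?P = "\<lambda>R. mult_indicator (cball 0 R)"
  show "((\<lambda>R. ?T R u \<bullet> cnj_L2 (?P R v)) \<longlongrightarrow> fourier_L2 u \<bullet> cnj_L2 v) at_top"
    by (intro tendsto_intros tendsto_cnj_L2 fourier_L2_tendsto mult_indicator_cball_tendsto)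
  have "?T R u \<bullet> cnj_L2 (?P R v) = ?P R u \<bullet> cnj_L2 (?T R v)" for R
    using fourier_integral_mult_formula[OF integrable_truncation integrable_truncation, of R u R v]
    by (simp add: mult_indicator_def cnj_L2_abs inner_abs_L2 square_integrable_cnj
        square_integrable_truncation square_integrable_fourier_trunc del: complex_cnj_mult flip: fourier_trunc_eq)
  moreover have "((\<lambda>R. ?P R u \<bullet> cnj_L2 (?T R v)) \<longlongrightarrow> u \<bullet> cnj_L2 (fourier_L2 v)) at_top"
    by (intro tendsto_intros tendsto_cnj_L2 fourier_L2_tendsto mult_indicator_cball_tendsto)
  ultimately show "((\<lambda>R. ?T R u \<bullet> cnj_L2 (?P R v)) \<longlongrightarrow> u \<bullet> cnj_L2 (fourier_L2 v)) at_top"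
    by simp
qed simp

text \<open>
Conjugating the transform on both sides gives its adjoint, so the inversion formula suggests the
preimage v. The isometry and the transpose identity show that the transform of v, w and their scalar
product all have the same size, so the transform of v is w.
\<close>

lemma fourier_L2_surj:
  fixes w :: "'a::euclidean_space L2"
  shows "\<exists>v. fourier_L2 v = w"
proof -
  define L where "L = (2 * pi) ^ DIM('a)"
  define x where "x = cnj_L2 (fourier_L2 (cnj_L2 w))"
  define v where "v = x /\<^sub>R L"
  have L: "L > 0" by (simp add: L_def)
  have "x \<bullet> x = fourier_L2 (cnj_L2 w) \<bullet> fourier_L2 (cnj_L2 w)"
    unfolding x_def by (simp flip: power2_norm_eq_inner)
  also have "\<dots> = L * (w \<bullet> w)"
    unfolding inner_fourier_L2 L_def[symmetric] by (simp flip: power2_norm_eq_inner)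
  finally have xx: "x \<bullet> x = L * (w \<bullet> w)" .
  have "fourier_L2 v \<bullet> w = v \<bullet> x"
    using fourier_L2_transpose[of v "cnj_L2 w"] by (simp add: x_def)
  then have "fourier_L2 v \<bullet> w = w \<bullet> w"
    using L by (simp add: v_def xx)
  moreover have "fourier_L2 v \<bullet> fourier_L2 v = w \<bullet> w"
    unfolding inner_fourier_L2 L_def[symmetric] using L by (simp add: v_def xx)
  ultimately have "(fourier_L2 v - w) \<bullet> (fourier_L2 v - w) = 0"
    by (simp add: inner_diff inner_commute)
  then show ?thesis by auto
qed

lemma fourier_L2_inject: "fourier_L2 u = fourier_L2 v \<longleftrightarrow> u = v"
proof -
  have "norm (fourier_L2 (u - v)) = 0 \<longleftrightarrow> u = v"
    by (simp add: norm_fourier_L2)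
  then show ?thesis by (simp add: fourier_L2_diff)
qed

section \<open>Bounded Fourier multipliers\<close>

text \<open>
Near infinity F is close to its limit, and what is left is a compact interval.
\<close>

lemma bounded_of_limit_at_top:
  fixes F :: "real \<Rightarrow> real"
  assumes cont: "continuous_on {0..} F" and lim: "(F \<longlongrightarrow> l) at_top"
  shows "\<exists>B. \<forall>r\<ge>0. \<bar>F r\<bar> \<le> B"
proof -
  have "eventually (\<lambda>r. dist (F r) l < 1) at_top"
    using lim by (rule tendstoD) simp
  then obtain N where N: "\<And>r. r \<ge> N \<Longrightarrow> dist (F r) l < 1"
    unfolding eventually_at_top_linorder by blast
  have "compact (F ` {0..N})"
    using cont by (intro compact_continuous_image continuous_on_subset[OF cont]) auto
  then obtain C where C: "\<And>r. r \<in> {0..N} \<Longrightarrow> norm (F r) \<le> C"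
    using compact_imp_bounded bounded_iff by (metis imageI)
  have "\<bar>F r\<bar> \<le> max C (\<bar>l\<bar> + 1)" if "r \<ge> 0" for r
  proof (cases "r \<le> N")
    case True
    then show ?thesis using C[of r] that by auto
  next
    case False
    then show ?thesis using N[of r] by (auto simp: dist_real_def)
  qed
  then show ?thesis by blast
qed

text \<open>
The action of F(|D|) on the Fourier side.
\<close>

definition symbol_mult :: "(real \<Rightarrow> real) \<Rightarrow> 'a::euclidean_space L2 \<Rightarrow> 'a L2" where
  "symbol_mult F w = abs_L2 (\<lambda>\<xi>. complex_of_real (F (norm \<xi>)) * rep_L2 w \<xi>)"

lemma square_integrable_symbol_mult:
  fixes g :: "'a::euclidean_space \<Rightarrow> complex"
  assumes cont: "continuous_on {0..} F" and bound: "\<And>r. r \<ge> 0 \<Longrightarrow> \<bar>F r\<bar> \<le> B"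
    and g: "square_integrable g"
  shows "square_integrable (\<lambda>\<xi>. complex_of_real (F (norm \<xi>)) * g \<xi>)"
proof (rule square_integrable_bound[OF _ square_integrable_cmult[OF g, of "complex_of_real B"]])
  have "continuous_on UNIV (\<lambda>\<xi>::'a. F (norm \<xi>))"
    by (rule continuous_on_compose2[OF cont]) (auto intro: continuous_intros)
  then have [measurable]: "(\<lambda>\<xi>::'a. F (norm \<xi>)) \<in> borel_measurable lebesgue"
    by (intro measurable_completion) (simp add: borel_measurable_continuous_onI)
  have [measurable]: "g \<in> borel_measurable lebesgue"
    using g by (simp add: square_integrable_def)
  show "(\<lambda>\<xi>. complex_of_real (F (norm \<xi>)) * g \<xi>) \<in> borel_measurable lebesgue"
    by measurable
  show "cmod (complex_of_real (F (norm \<xi>)) * g \<xi>) \<le> cmod (complex_of_real B * g \<xi>)" for \<xi>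
    using bound[of "norm \<xi>"] by (auto simp: norm_mult intro!: mult_right_mono)
qed

locale bounded_symbol =
  fixes F :: "real \<Rightarrow> real" and B :: real
  assumes cont: "continuous_on {0..} F" and bound: "\<And>r. r \<ge> 0 \<Longrightarrow> \<bar>F r\<bar> \<le> B"
begin

lemmas square_integrable_mult = square_integrable_symbol_mult[OF cont bound]

lemma symbol_mult_abs:
  fixes g :: "'a::euclidean_space \<Rightarrow> complex"
  assumes g: "square_integrable g"
  shows "symbol_mult F (abs_L2 g) = abs_L2 (\<lambda>\<xi>. complex_of_real (F (norm \<xi>)) * g \<xi>)"
  unfolding symbol_mult_def
  using rep_abs_L2[OF g]
  by (subst abs_L2_eq_iff) (auto intro!: square_integrable_mult g square_integrable_rep_L2)

lemma symbol_mult_self_adjoint: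
  fixes u v :: "'a::euclidean_space L2"
  shows "symbol_mult F u \<bullet> v = u \<bullet> symbol_mult F v"
proof -
  have "symbol_mult F (abs_L2 f) \<bullet> abs_L2 g = abs_L2 f \<bullet> symbol_mult F (abs_L2 g)"
    if "square_integrable f" "square_integrable g" for f g :: "'a \<Rightarrow> complex"
    using that by (simp add: symbol_mult_abs inner_abs_L2 square_integrable_mult) (simp add: mult_ac)
  from this[OF square_integrable_rep_L2 square_integrable_rep_L2, of u v]
  show ?thesis by (simp add: abs_rep_L2)
qed

lemma multiplier_dom_eq_UNIV: "multiplier_dom F = (UNIV :: 'a::euclidean_space L2 set)"
  by (auto simp: multiplier_dom_def intro!: square_integrable_mult square_integrable_rep_L2)

text \<open>
Injectivity and surjectivity of the transform make the definite description in the multiplier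
meaningful.
\<close>

lemma fourier_L2_multiplier:
  fixes u :: "'a::euclidean_space L2"
  shows "fourier_L2 (multiplier F u) = symbol_mult F (fourier_L2 u)"
proof -
  obtain v where v: "fourier_L2 v = symbol_mult F (fourier_L2 u)"
    using fourier_L2_surj by blast
  have "multiplier F u = (THE v. fourier_L2 v = symbol_mult F (fourier_L2 u))"
    by (simp add: multiplier_def symbol_mult_def)
  also have "\<dots> = v"
  proof (rule the_equality)
    show "v' = v" if "fourier_L2 v' = symbol_mult F (fourier_L2 u)" for v'
      using that v fourier_L2_inject[of v' v] by simp
  qed (rule v)
  finally show ?thesis using v by simp
qed

text \<open>
By the Parseval identity the difference F(|D|) - l can be moved onto g, where it is small for the
functions g constructed below.
\<close>

lemma inner_multiplier_minus:
  fixes g u :: "'a::euclidean_space L2"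
  shows "\<bar>g \<bullet> (multiplier F u - l *\<^sub>R u)\<bar>
    \<le> norm (symbol_mult F (fourier_L2 g) - l *\<^sub>R fourier_L2 g) / sqrt (2 * pi) ^ DIM('a) * norm u"
proof -
  let ?c = "sqrt (2 * pi) ^ DIM('a)"
  have c2: "(2 * pi) ^ DIM('a) = ?c * ?c"
    unfolding power_mult_distrib[symmetric] by simp
  have "?c * ?c * (g \<bullet> (multiplier F u - l *\<^sub>R u))
      = fourier_L2 g \<bullet> fourier_L2 (multiplier F u) - l * (fourier_L2 g \<bullet> fourier_L2 u)"
    unfolding inner_fourier_L2 c2 by (simp add: inner_diff_right algebra_simps)
  also have "\<dots> = (symbol_mult F (fourier_L2 g) - l *\<^sub>R fourier_L2 g) \<bullet> fourier_L2 u"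
    by (simp add: fourier_L2_multiplier symbol_mult_self_adjoint inner_diff_left)
  finally have "?c * ?c * \<bar>g \<bullet> (multiplier F u - l *\<^sub>R u)\<bar>
      = \<bar>(symbol_mult F (fourier_L2 g) - l *\<^sub>R fourier_L2 g) \<bullet> fourier_L2 u\<bar>"
    by (metis abs_mult abs_mult_self_eq)
  also have "\<dots> \<le> norm (symbol_mult F (fourier_L2 g) - l *\<^sub>R fourier_L2 g) * (?c * norm u)"
    using Cauchy_Schwarz_ineq2[of "symbol_mult F (fourier_L2 g) - l *\<^sub>R fourier_L2 g" "fourier_L2 u"]
    by (simp only: norm_fourier_L2)
  finally have "?c * (?c * \<bar>g \<bullet> (multiplier F u - l *\<^sub>R u)\<bar>)
      \<le> ?c * (norm (symbol_mult F (fourier_L2 g) - l *\<^sub>R fourier_L2 g) * norm u)"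
    by (simp only: mult_ac)
  then show ?thesis
    by (simp add: mult_le_cancel_left_pos field_simps)
qed

end

section \<open>Concentrated functions as approximate eigenvectors\<close>

lemma small_ball:
  fixes x0 :: "'a::euclidean_space"
  assumes "r0 > 0" "\<eta> > 0"
  obtains r where "0 < r" "r \<le> r0" "measure lebesgue (ball x0 r) \<le> \<eta>"
proof -
  let ?V = "measure lebesgue (ball (0::'a) 1)"
  define r where "r = min 1 (min r0 (\<eta> / (?V + 1)))"
  have V: "?V \<ge> 0" by simp
  have r: "0 < r" "r \<le> r0" "r \<le> 1" "r \<le> \<eta> / (?V + 1)"
    using assms V by (auto simp: r_def intro!: divide_pos_pos add_nonneg_pos)
  have "measure lebesgue (ball x0 r) = r ^ DIM('a) * ?V"
    using r content_ball_conv_unit_ball[of r x0] by simp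
  also have "\<dots> \<le> r * ?V"
    using r power_decreasing[of 1 "DIM('a)" r] by (intro mult_right_mono) (auto simp: DIM_positive Suc_leI)
  also have "\<dots> \<le> \<eta> / (?V + 1) * ?V"
    using r by (intro mult_right_mono) auto
  also have "\<dots> = \<eta> * (?V / (?V + 1))" by simp
  also have "\<dots> \<le> \<eta> * 1"
    using V assms by (intro mult_left_mono) (auto intro!: divide_le_eq_1_pos[THEN iffD2] add_nonneg_pos)
  finally show ?thesis using that r by simp
qed

definition normalized_ball :: "'a::euclidean_space \<Rightarrow> real \<Rightarrow> 'a \<Rightarrow> complex" where
  "normalized_ball x0 r x = complex_of_real (indicator (ball x0 r) x / sqrt (measure lebesgue (ball x0 r)))"

lemma normalized_ball:
  fixes x0 :: "'a::euclidean_space"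
  assumes "r > 0"
  defines "V \<equiv> measure lebesgue (ball x0 r)"
  shows "square_integrable (normalized_ball x0 r)"
    and "norm (abs_L2 (normalized_ball x0 r)) = 1"
    and "cmod (fourier_integral (normalized_ball x0 r) \<xi>) \<le> sqrt V"
proof -
  have V: "V > 0"
    using content_ball_pos[OF assms(1), of x0] by (simp add: V_def)
  have fin: "integrable lebesgue (\<lambda>x. indicator (ball x0 r) x :: real)"
    using emeasure_lborel_ball_finite[of x0 r] by (simp add: integrable_indicator_iff less_top)
  have I: "(LINT x|lebesgue. indicator (ball x0 r) x) = V"
    by (simp add: V_def)
  have n: "cmod (normalized_ball x0 r x) = indicator (ball x0 r) x / sqrt V" for x
    using V by (simp add: normalized_ball_def V_def[symmetric] indicator_def norm_divide)
  have sq: "(cmod (normalized_ball x0 r x))\<^sup>2 = indicator (ball x0 r) x / V" for x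
    using V by (simp add: n power_divide indicator_def)
  show sqi: "square_integrable (normalized_ball x0 r)"
    unfolding square_integrable_def sq
  proof
    have [measurable]: "indicat_real (ball x0 r) \<in> borel_measurable lebesgue"
      using fin by simp
    have "(\<lambda>x. complex_of_real (indicator (ball x0 r) x / sqrt V)) \<in> borel_measurable lebesgue"
      by measurable
    then show "normalized_ball x0 r \<in> borel_measurable lebesgue"
      by (simp add: normalized_ball_def[abs_def] V_def)
    show "integrable lebesgue (\<lambda>x. indicat_real (ball x0 r) x / V)"
      using fin by (rule integrable_divide_zero)
  qed
  show "norm (abs_L2 (normalized_ball x0 r)) = 1"
    unfolding norm_abs_L2[OF sqi] sq integral_divide_zero I using V by simp
  have "cmod (fourier_integral (normalized_ball x0 r) \<xi>) \<le> V / sqrt V"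
    using norm_fourier_integral_le[of "normalized_ball x0 r" \<xi>] unfolding n integral_divide_zero I .
  then show "cmod (fourier_integral (normalized_ball x0 r) \<xi>) \<le> sqrt V"
    using V by (simp add: real_div_sqrt)
qed

lemma normalized_ball_eq_0: "x \<notin> ball x0 r \<Longrightarrow> normalized_ball x0 r x = 0"
  by (simp add: normalized_ball_def)

text \<open>
The transform of the normalized indicator is bounded by the square root of the volume of the ball, so on
any fixed frequency ball, where F - l is merely bounded, its mass vanishes with the radius. Outside a large
frequency ball F - l is small and the mass is bounded by Plancherel's identity.
\<close>

lemma (in bounded_symbol) normalized_ball_approx_eigenvector:
  fixes x0 :: "'a::euclidean_space"
  assumes lim: "(F \<longlongrightarrow> l) at_top" and r0: "r0 > 0" and \<epsilon>: "\<epsilon> > 0"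
  obtains r where "0 < r" "r \<le> r0"
    "norm (symbol_mult F (fourier_L2 (abs_L2 (normalized_ball x0 r)))
       - l *\<^sub>R fourier_L2 (abs_L2 (normalized_ball x0 r))) \<le> \<epsilon>"
proof -
  let ?c = "sqrt (2 * pi) ^ DIM('a)"
  define \<delta> where "\<delta> = \<epsilon> / (2 * ?c)"
  have c: "?c > 0" by simp
  have \<delta>: "\<delta> > 0" using \<epsilon> by (simp add: \<delta>_def)
  have "eventually (\<lambda>r. dist (F r) l < \<delta>) at_top"
    using lim \<delta> by (rule tendstoD)
  then obtain N where N: "\<And>r. r \<ge> N \<Longrightarrow> \<bar>F r - l\<bar> < \<delta>"
    unfolding eventually_at_top_linorder dist_real_def by blast
  \<comment> \<open>The summand 1 makes C positive, which is convenient for the division in the choice of \<open>\<eta>\<close>.\<close>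
  define C where "C = B + \<bar>l\<bar> + 1"
  have B: "B \<ge> 0" using bound[of 0] by simp
  have C: "C > 0" using B by (simp add: C_def)
  have F_le: "\<bar>F r - l\<bar> \<le> C" if "r \<ge> 0" for r
    using bound[OF that] by (simp add: C_def)
  define W where "W = measure lebesgue (cball (0::'a) N)"
  have W: "W \<ge> 0" by (simp add: W_def)
  \<comment> \<open>A ball of volume at most \<open>\<eta>\<close> makes the low frequencies contribute at most half of \<open>\<epsilon>\<^sup>2\<close>.\<close>
  define \<eta> where "\<eta> = \<epsilon>\<^sup>2 / (2 * C\<^sup>2 * (W + 1))"
  have \<eta>: "\<eta> > 0" using \<epsilon> C W by (auto simp: \<eta>_def)
  obtain r where r: "0 < r" "r \<le> r0" "measure lebesgue (ball x0 r) \<le> \<eta>"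
    by (rule small_ball[OF r0 \<eta>])
  let ?f = "normalized_ball x0 r"
  let ?h = "fourier_integral ?f"
  note f = normalized_ball[OF r(1), of x0]
  have supp: "?f x = 0" if "norm x > norm x0 + r" for x
  proof (rule normalized_ball_eq_0)
    show "x \<notin> ball x0 r"
      using that norm_triangle_ineq[of x0 "x - x0"] by (auto simp: dist_norm norm_minus_commute)
  qed
  have fL: "fourier_L2 (abs_L2 ?f) = abs_L2 ?h"
    by (rule fourier_L2_abs_L2[OF f(1) supp])
  have "Plancherel ?f" by (rule Plancherel_bounded_support[OF f(1) supp])
  then have h: "square_integrable ?h" "norm (abs_L2 ?h) = ?c"
    by (simp_all add: Plancherel_def f)
  have hW: "(cmod (?h \<xi>))\<^sup>2 \<le> \<eta>" for \<xi>
  proof -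
    have "(cmod (?h \<xi>))\<^sup>2 \<le> (sqrt (measure lebesgue (ball x0 r)))\<^sup>2"
      using f(3) by (intro power_mono) auto
    then show ?thesis using r(3) by simp
  qed
  define k where "k \<xi> = complex_of_real (F (norm \<xi>)) * ?h \<xi> - complex_of_real l * ?h \<xi>" for \<xi>
  have k: "square_integrable k"
    unfolding k_def by (intro square_integrable_diff square_integrable_mult square_integrable_cmult h)
  have diff: "symbol_mult F (fourier_L2 (abs_L2 ?f)) - l *\<^sub>R fourier_L2 (abs_L2 ?f) = abs_L2 k"
    unfolding fL k_def
    by (simp add: symbol_mult_abs h abs_L2_scaleR abs_L2_diff square_integrable_mult square_integrable_cmult)
  have k_le: "(cmod (k \<xi>))\<^sup>2 \<le> C\<^sup>2 * \<eta> * indicator (cball 0 N) \<xi> + \<delta>\<^sup>2 * (cmod (?h \<xi>))\<^sup>2" for \<xi>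
  proof -
    have "k \<xi> = complex_of_real (F (norm \<xi>) - l) * ?h \<xi>"
      by (simp add: k_def algebra_simps)
    then have eq: "(cmod (k \<xi>))\<^sup>2 = \<bar>F (norm \<xi>) - l\<bar>\<^sup>2 * (cmod (?h \<xi>))\<^sup>2"
      by (simp only: norm_mult norm_of_real power_mult_distrib)
    show ?thesis
    proof (cases "norm \<xi> \<le> N")
      case True
      have "\<bar>F (norm \<xi>) - l\<bar>\<^sup>2 * (cmod (?h \<xi>))\<^sup>2 \<le> C\<^sup>2 * \<eta>"
        using F_le[of "norm \<xi>"] hW by (intro mult_mono power_mono) auto
      also have "\<dots> \<le> C\<^sup>2 * \<eta> + \<delta>\<^sup>2 * (cmod (?h \<xi>))\<^sup>2" by simp
      finally show ?thesis using True unfolding eq by simp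
    next
      case False
      then have "\<bar>F (norm \<xi>) - l\<bar>\<^sup>2 * (cmod (?h \<xi>))\<^sup>2 \<le> \<delta>\<^sup>2 * (cmod (?h \<xi>))\<^sup>2"
        using N[of "norm \<xi>"] by (intro mult_right_mono power_mono) auto
      then show ?thesis using False unfolding eq by simp
    qed
  qed
  have ind: "integrable lebesgue (\<lambda>\<xi>::'a. C\<^sup>2 * \<eta> * indicator (cball 0 N) \<xi>)"
    by (rule integrable_indicator_cball)
  have hint: "integrable lebesgue (\<lambda>\<xi>. \<delta>\<^sup>2 * (cmod (?h \<xi>))\<^sup>2)"
    using h(1) by (simp add: square_integrable_def)
  have "(norm (abs_L2 k))\<^sup>2 = (LINT \<xi>|lebesgue. (cmod (k \<xi>))\<^sup>2)"
    by (rule power2_norm_abs_L2[OF k])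
  also have "\<dots> \<le> (LINT \<xi>|lebesgue. C\<^sup>2 * \<eta> * indicator (cball 0 N) \<xi> + \<delta>\<^sup>2 * (cmod (?h \<xi>))\<^sup>2)"
    using k by (intro integral_mono_AE Bochner_Integration.integrable_add ind hint AE_I2 k_le)
       (simp add: square_integrable_def)
  also have "\<dots> = C\<^sup>2 * \<eta> * W + \<delta>\<^sup>2 * (norm (abs_L2 ?h))\<^sup>2"
    unfolding Bochner_Integration.integral_add[OF ind hint] integral_mult_right_zero power2_norm_abs_L2[OF h(1)]
    by (simp add: W_def)
  also have "\<dots> \<le> \<epsilon>\<^sup>2"
  proof -
    have "C\<^sup>2 * \<eta> * W = \<epsilon>\<^sup>2 / 2 * (W / (W + 1))"
      using C W by (simp add: \<eta>_def)
    also have "\<dots> \<le> \<epsilon>\<^sup>2 / 2 * 1"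
      using W by (intro mult_left_mono) auto
    finally have "C\<^sup>2 * \<eta> * W \<le> \<epsilon>\<^sup>2 / 2" by simp
    moreover have "\<delta>\<^sup>2 * (norm (abs_L2 ?h))\<^sup>2 = (\<epsilon> / 2)\<^sup>2"
      unfolding h(2) power_mult_distrib[symmetric] by (simp add: \<delta>_def)
    moreover have "(\<epsilon> / 2)\<^sup>2 \<le> \<epsilon>\<^sup>2 / 2"
      by (simp add: power_divide)
    ultimately show ?thesis by linarith
  qed
  finally have "norm (abs_L2 k) \<le> \<epsilon>"
    by (rule power2_le_imp_le) (use \<epsilon> in simp)
  then show ?thesis
    unfolding diff[symmetric] by (rule that[OF r(1,2)])
qed

lemma inner_mult_indicator_eq_0:
  assumes f: "square_integrable f" and \<omega>: "\<omega> \<in> sets lebesgue" and disj: "\<And>x. x \<in> \<omega> \<Longrightarrow> f x = 0"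
  shows "abs_L2 f \<bullet> mult_indicator \<omega> v = 0"
proof -
  have "(\<lambda>x. f x * cnj (indicator \<omega> x * rep_L2 v x)) = (\<lambda>_. 0)"
  proof
    show "f x * cnj (indicator \<omega> x * rep_L2 v x) = 0" for x
      using disj[of x] by (auto simp: indicator_def)
  qed
  then show ?thesis
    unfolding mult_indicator_def
    by (subst inner_abs_L2)
       (simp_all add: f square_integrable_indicator_mult square_integrable_rep_L2 \<omega> del: complex_cnj_mult)
qed

section \<open>Decay of semigroups and approximate eigenvectors of the adjoint\<close>

text \<open>
The generator only gives right derivatives at 0. The semigroup law moves them to t on the right; on the
left, T (t - h) is applied to the difference quotients at 0, and the uniform bound on T together with
strong continuity lets h tend to 0. Both sides agree because the generator commutes with T t.
\<close>

lemma semigroup_has_derivative: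
  fixes T :: "real \<Rightarrow> 'a::euclidean_space L2 \<Rightarrow> 'a L2"
  assumes sg: "C0_semigroup T" and gen: "has_generator T UNIV A"
    and bound: "\<And>t u. t \<ge> 0 \<Longrightarrow> norm (T t u) \<le> C * norm u" and C: "C \<ge> 0" and t: "t > 0"
  shows "((\<lambda>s. g \<bullet> T s u) has_real_derivative g \<bullet> A (T t u)) (at t)"
proof -
  have lin: "bounded_linear (T s)" if "s \<ge> 0" for s
    using sg that by (auto simp: C0_semigroup_def bounded_clinear_def)
  have add: "T (s + s') v = T s (T s' v)" if "s \<ge> 0" "s' \<ge> 0" for s s' v
    using sg that by (auto simp: C0_semigroup_def)
  have cont: "((\<lambda>s. T s v) \<longlongrightarrow> v) (at_right 0)" for v
    using sg by (auto simp: C0_semigroup_def)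
  define D where "D v h = (T h v - v) /\<^sub>R h" for v h
  have D: "(D v \<longlongrightarrow> A v) (at_right 0)" for v
    using gen unfolding has_generator_def D_def by auto
  have "((\<lambda>h. T t (D u h)) \<longlongrightarrow> T t (A u)) (at_right 0)"
    using t by (intro bounded_linear.tendsto[OF lin] D) simp
  moreover have "((\<lambda>h. T t (D u h)) \<longlongrightarrow> A (T t u)) (at_right 0)"
  proof (rule Lim_transform_eventually[OF D[of "T t u"]])
    show "eventually (\<lambda>h. D (T t u) h = T t (D u h)) (at_right 0)"
      using eventually_at_right_less[of "0::real"]
    proof eventually_elim
      fix h :: real assume "0 < h"
      then have "T h (T t u) = T t (T h u)"
        using add[of h t u] add[of t h u] t by (simp add: add.commute)
      then show "D (T t u) h = T t (D u h)"
        using linear_diff[OF bounded_linear.linear[OF lin]] linear_scale[OF bounded_linear.linear[OF lin]] t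
        by (simp add: D_def)
    qed
  qed
  ultimately have comm: "T t (A u) = A (T t u)"
    by (rule tendsto_unique[OF trivial_limit_at_right_real])
  have right: "((\<lambda>s. (g \<bullet> T s u - g \<bullet> T t u) / (s - t)) \<longlongrightarrow> g \<bullet> A (T t u)) (at_right t)"
    unfolding filterlim_at_right_to_0[of _ _ t]
  proof (rule Lim_transform_eventually)
    show "((\<lambda>h. g \<bullet> D (T t u) h) \<longlongrightarrow> g \<bullet> A (T t u)) (at_right 0)"
      by (intro tendsto_intros D)
    show "eventually (\<lambda>h. g \<bullet> D (T t u) h = (g \<bullet> T (h + t) u - g \<bullet> T t u) / (h + t - t)) (at_right 0)"
      using eventually_at_right_less[of "0::real"]
      by eventually_elim (use add t in \<open>simp add: D_def inner_diff_right divide_inverse mult.commute\<close>)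
  qed
  have "((\<lambda>h. T (t - h) (D u h) - T t (A u)) \<longlongrightarrow> 0) (at_right 0)"
  proof (rule Lim_null_comparison)
    show "eventually (\<lambda>h. norm (T (t - h) (D u h) - T t (A u))
        \<le> C * (norm (D u h - A u) + norm (A u - T h (A u)))) (at_right 0)"
      using eventually_at_right_real[OF t]
    proof eventually_elim
      fix h assume "h \<in> {0<..<t}"
      then have h: "0 \<le> h" "0 \<le> t - h" by auto
      have "T (t - h) (D u h) - T t (A u) = T (t - h) (D u h - T h (A u))"
        using add[OF h(2,1), of "A u"] linear_diff[OF bounded_linear.linear[OF lin[OF h(2)]]] by simp
      then have "norm (T (t - h) (D u h) - T t (A u)) \<le> C * norm (D u h - T h (A u))"
        using bound[OF h(2)] by simp
      also have "\<dots> \<le> C * (norm (D u h - A u) + norm (A u - T h (A u)))"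
        using norm_triangle_ineq[of "D u h - A u" "A u - T h (A u)"] C by (intro mult_left_mono) auto
      finally show "norm (T (t - h) (D u h) - T t (A u))
        \<le> C * (norm (D u h - A u) + norm (A u - T h (A u)))" .
    qed
    have "((\<lambda>h. C * (norm (D u h - A u) + norm (A u - T h (A u)))) \<longlongrightarrow>
        C * (norm (A u - A u) + norm (A u - A u))) (at_right 0)"
      by (intro tendsto_intros D cont)
    then show "((\<lambda>h. C * (norm (D u h - A u) + norm (A u - T h (A u)))) \<longlongrightarrow> 0) (at_right 0)"
      by simp
  qed
  then have L: "((\<lambda>h. T (t - h) (D u h)) \<longlongrightarrow> A (T t u)) (at_right 0)"
    by (simp add: LIM_zero_iff comm)
  have left: "((\<lambda>s. (g \<bullet> T s u - g \<bullet> T t u) / (s - t)) \<longlongrightarrow> g \<bullet> A (T t u)) (at_left t)"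
    unfolding filterlim_at_left_to_right[of _ _ t] filterlim_at_right_to_0[of _ _ "- t"]
  proof (rule Lim_transform_eventually)
    show "((\<lambda>h. g \<bullet> T (t - h) (D u h)) \<longlongrightarrow> g \<bullet> A (T t u)) (at_right 0)"
      by (intro tendsto_intros L)
    show "eventually (\<lambda>h. g \<bullet> T (t - h) (D u h)
        = (g \<bullet> T (- (h + - t)) u - g \<bullet> T t u) / (- (h + - t) - t)) (at_right 0)"
      using eventually_at_right_real[OF t]
    proof eventually_elim
      fix h assume "h \<in> {0<..<t}"
      then have h: "0 < h" "0 \<le> h" "0 \<le> t - h" by auto
      have "T (t - h) (D u h) = (T t u - T (t - h) u) /\<^sub>R h"
        using add[OF h(3,2), of u] linear_diff[OF bounded_linear.linear[OF lin[OF h(3)]]]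
          linear_scale[OF bounded_linear.linear[OF lin[OF h(3)]]]
        by (simp add: D_def)
      then have "g \<bullet> T (t - h) (D u h) = (g \<bullet> T t u - g \<bullet> T (t - h) u) / h"
        by (simp only: inner_scaleR_right inner_diff_right divide_inverse mult.commute)
      moreover have "- (h + - t) = t - h" by simp
      ultimately show "g \<bullet> T (t - h) (D u h) = (g \<bullet> T (- (h + - t)) u - g \<bullet> T t u) / (- (h + - t) - t)"
        by (simp add: diff_divide_distrib)
    qed
  qed
  show ?thesis
    unfolding has_field_derivative_iff using filterlim_split_at[OF left right] .
qed

text \<open>
The hypothesis on g says that - l is an approximate eigenvalue of the adjoint of A with approximate
eigenvector g. It bounds from below the derivative of exp (l t) times the scalar product of g and T t g;
the decay of T makes this bound integrable and the function itself tend to 0.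
\<close>

lemma semigroup_decay_excludes_approx_eigenvector:
  fixes T :: "real \<Rightarrow> 'a::euclidean_space L2 \<Rightarrow> 'a L2"
  assumes sg: "C0_semigroup T" and gen: "has_generator T UNIV A"
    and decay: "\<And>t u. t \<ge> 0 \<Longrightarrow> norm (T t u) \<le> M * exp (- \<alpha> * t) * norm u"
    and \<alpha>: "\<alpha> \<ge> 0" "\<alpha> > l" and M: "M \<ge> 0"
    and approx: "\<And>u. g \<bullet> (A u + l *\<^sub>R u) \<ge> - \<epsilon> * norm u" and \<epsilon>: "\<epsilon> \<ge> 0"
  shows "norm g \<le> \<epsilon> * M / (\<alpha> - l)"
proof -
  define \<beta> where "\<beta> = \<alpha> - l"
  have \<beta>: "\<beta> > 0" using \<alpha> by (simp add: \<beta>_def)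
  define E where "E = \<epsilon> * M * norm g"
  \<comment> \<open>The second term is a primitive of the lower bound for the derivative of the first, so \<open>\<psi>\<close> is nondecreasing.\<close>
  define \<psi> where "\<psi> t = exp (l * t) * (g \<bullet> T t g) - E / \<beta> * exp (- \<beta> * t)" for t
  have bound: "norm (T t u) \<le> M * norm u" if "t \<ge> 0" for t u
  proof -
    have "M * exp (- \<alpha> * t) * norm u \<le> M * 1 * norm u"
      using \<alpha> that M by (intro mult_right_mono mult_left_mono) auto
    then show ?thesis using decay[OF that, of u] by simp
  qed
  have deriv: "(\<psi> has_real_derivative exp (l * t) * (g \<bullet> (A (T t g) + l *\<^sub>R T t g)) + E * exp (- \<beta> * t)) (at t)"
    if "t > 0" for t
  proof -
    have e: "((\<lambda>s. exp (c * s)) has_real_derivative exp (c * t) * c) (at t)" for c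
      by (auto intro!: derivative_eq_intros)
    have "(\<psi> has_real_derivative (exp (l * t) * l * (g \<bullet> T t g) + g \<bullet> A (T t g) * exp (l * t))
        - E / \<beta> * (exp (- \<beta> * t) * - \<beta>)) (at t)"
      unfolding \<psi>_def
      by (intro DERIV_diff DERIV_mult DERIV_cmult e semigroup_has_derivative[OF sg gen bound M that])
    then show ?thesis
      by (rule DERIV_cong) (use \<beta> in \<open>simp add: inner_add_right distrib_left mult_ac\<close>)
  qed
  have nonneg: "exp (l * t) * (g \<bullet> (A (T t g) + l *\<^sub>R T t g)) + E * exp (- \<beta> * t) \<ge> 0" if "t > 0" for t
  proof -
    have "exp (l * t) * (\<epsilon> * norm (T t g)) \<le> exp (l * t) * (\<epsilon> * (M * exp (- \<alpha> * t) * norm g))"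
      using decay[OF less_imp_le[OF that], of g] \<epsilon> by (intro mult_left_mono) simp_all
    also have "\<dots> = E * (exp (l * t) * exp (- \<alpha> * t))"
      by (simp add: E_def)
    also have "exp (l * t) * exp (- \<alpha> * t) = exp (- \<beta> * t)"
      unfolding exp_add[symmetric] \<beta>_def by (simp add: algebra_simps)
    finally have "exp (l * t) * (\<epsilon> * norm (T t g)) \<le> E * exp (- \<beta> * t)" .
    moreover have "exp (l * t) * (- \<epsilon> * norm (T t g)) \<le> exp (l * t) * (g \<bullet> (A (T t g) + l *\<^sub>R T t g))"
      by (intro mult_left_mono approx) simp
    ultimately show ?thesis by simp
  qed
  have T0: "T 0 g = g" and cont0: "((\<lambda>t. T t g) \<longlongrightarrow> g) (at_right 0)"
    using sg by (auto simp: C0_semigroup_def)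
  \<comment> \<open>At 0 the orbit is differentiable only from the right, hence the mean value theorem on the open interval.\<close>
  have mono: "\<psi> 0 \<le> \<psi> b" if b: "b > 0" for b
  proof -
    have "continuous_on {0..b} \<psi>"
      unfolding continuous_on_eq_continuous_within
    proof
      fix t assume t: "t \<in> {0..b}"
      show "continuous (at t within {0..b}) \<psi>"
      proof (cases "t = 0")
        case True
        have "(\<psi> \<longlongrightarrow> exp (l * 0) * (g \<bullet> g) - E / \<beta> * exp (- \<beta> * 0)) (at_right 0)"
          unfolding \<psi>_def by (intro tendsto_intros cont0)
        then show ?thesis
          using b True by (simp add: continuous_within at_within_Icc_at_right \<psi>_def T0)
      next
        case False
        then show ?thesis
          using t deriv[of t] by (auto intro: continuous_at_imp_continuous_at_within DERIV_isCont)
      qed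
    qed
    then obtain y z where z: "0 < z" "z < b" "DERIV \<psi> z :> y" "\<psi> b - \<psi> 0 = (b - 0) * y"
      using MVT[of 0 b \<psi>] b deriv by (auto simp: real_differentiable_def)
    then have "y \<ge> 0"
      using DERIV_unique[OF z(3) deriv[OF z(1)]] nonneg[OF z(1)] by simp
    then have "(b - 0) * y \<ge> 0" using b by simp
    then show ?thesis using z(4) by linarith
  qed
  have "\<psi> b \<le> (M * (norm g)\<^sup>2 - E / \<beta>) * exp (- \<beta> * b)" if b: "b > 0" for b
  proof -
    have "g \<bullet> T b g \<le> norm g * norm (T b g)"
      by (rule norm_cauchy_schwarz)
    also have "\<dots> \<le> norm g * (M * exp (- \<alpha> * b) * norm g)"
      using decay[of b g] b by (intro mult_left_mono) auto
    finally have "exp (l * b) * (g \<bullet> T b g) \<le> exp (l * b) * (norm g * (M * exp (- \<alpha> * b) * norm g))"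
      by (intro mult_left_mono) auto
    also have "\<dots> = M * (norm g)\<^sup>2 * (exp (l * b) * exp (- \<alpha> * b))"
      by (simp add: power2_eq_square)
    also have "exp (l * b) * exp (- \<alpha> * b) = exp (- \<beta> * b)"
      unfolding exp_add[symmetric] \<beta>_def by (simp add: algebra_simps)
    finally show ?thesis by (simp add: \<psi>_def algebra_simps)
  qed
  then have le: "\<psi> 0 \<le> (M * (norm g)\<^sup>2 - E / \<beta>) * exp (- \<beta> * b)" if "b > 0" for b
    using order_trans[OF mono[OF that]] that by simp
  have "((\<lambda>b. (M * (norm g)\<^sup>2 - E / \<beta>) * exp (- \<beta> * b)) \<longlongrightarrow> 0) at_top"
    using \<beta> by real_asymp
  moreover have "eventually (\<lambda>b. \<psi> 0 \<le> (M * (norm g)\<^sup>2 - E / \<beta>) * exp (- \<beta> * b)) at_top"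
    using eventually_gt_at_top[of "0::real"] by eventually_elim (rule le)
  ultimately have "\<psi> 0 \<le> 0"
    by (rule tendsto_lowerbound) simp
  moreover have "\<psi> 0 = norm g * norm g - norm g * (\<epsilon> * M / \<beta>)"
    by (simp add: \<psi>_def T0 E_def dot_square_norm power2_eq_square)
  ultimately have "norm g * norm g \<le> norm g * (\<epsilon> * M / \<beta>)"
    by linarith
  then have "g = 0 \<or> norm g \<le> \<epsilon> * M / \<beta>"
    using mult_left_le_imp_le[of "norm g" "norm g" "\<epsilon> * M / \<beta>"] by auto
  then show ?thesis
    using \<epsilon> M \<beta> by (auto simp: \<beta>_def)
qed

section \<open>Stabilization at rates above the supremum of the symbol\<close>

theorem proposition2p5:
  fixes F :: "real \<Rightarrow> real" and \<omega> :: "(real ^ 'n::finite) set" and \<alpha> l :: real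
  assumes "continuous_on {0..} F"
    and "bdd_below (F ` {0..})"
    and "\<omega> \<in> sets lebesgue"
    and "closure \<omega> \<noteq> UNIV"
    and "(F \<longlongrightarrow> l) at_top"
    and "l \<ge> 0"
    and "\<alpha> > (SUP r\<in>{0..}. F r)"
  shows "\<not> exp_stabilizable F \<omega> \<alpha>"
proof
  assume "exp_stabilizable F \<omega> \<alpha>"
  then obtain M K T where M: "M \<ge> 1" and sg: "C0_semigroup T"
    and gen: "has_generator T (multiplier_dom F) (\<lambda>u. - (multiplier F u + mult_indicator \<omega> (K u)))"
    and onorm_le: "\<And>t. t \<ge> 0 \<Longrightarrow> onorm (T t) \<le> M * exp (- \<alpha> * t)"
    unfolding exp_stabilizable_def semigroup_of_def by blast
  obtain B where B: "\<And>r. r \<ge> 0 \<Longrightarrow> \<bar>F r\<bar> \<le> B"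
    using bounded_of_limit_at_top[OF assms(1,5)] by blast
  interpret bounded_symbol F B
    using assms(1) B by unfold_locales
  have "bdd_above (F ` {0..})"
    using B by (intro bdd_aboveI2[of _ _ B]) (auto simp: abs_le_iff)
  then have F_le: "F r \<le> (SUP r\<in>{0..}. F r)" if "r \<ge> 0" for r
    using that by (intro cSUP_upper) auto
  have "eventually (\<lambda>r. F r \<le> (SUP r\<in>{0..}. F r)) at_top"
    using eventually_ge_at_top[of "0::real"] by eventually_elim (rule F_le)
  then have "l \<le> (SUP r\<in>{0..}. F r)"
    by (rule tendsto_upperbound[OF assms(5)]) simp
  then have \<alpha>: "\<alpha> > l" "\<alpha> \<ge> 0" using assms(6,7) by linarith+
  have decay: "norm (T t u) \<le> M * exp (- \<alpha> * t) * norm u" if "t \<ge> 0" for t u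
  proof -
    have "bounded_linear (T t)"
      using sg that by (auto simp: C0_semigroup_def bounded_clinear_def)
    then have "norm (T t u) \<le> onorm (T t) * norm u" by (rule onorm)
    also have "\<dots> \<le> M * exp (- \<alpha> * t) * norm u"
      using onorm_le[OF that] by (rule mult_right_mono) simp
    finally show ?thesis .
  qed
  obtain x0 where "x0 \<in> - closure \<omega>" using assms(4) by blast
  moreover have "open (- closure \<omega>)" by auto
  ultimately obtain r0 where r0: "r0 > 0" "ball x0 r0 \<subseteq> - closure \<omega>"
    using openE by metis
  let ?c = "sqrt (2 * pi) ^ DIM(real ^ 'n)"
  \<comment> \<open>With this choice the semigroup estimate bounds the norm of the unit vector below by 1/2.\<close>
  define \<epsilon> where "\<epsilon> = (\<alpha> - l) / (2 * M)"
  have \<epsilon>: "\<epsilon> > 0" using \<alpha> M by (simp add: \<epsilon>_def)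
  then have \<epsilon>c: "\<epsilon> * ?c > 0" by simp
  obtain r where r: "0 < r" "r \<le> r0"
    "norm (symbol_mult F (fourier_L2 (abs_L2 (normalized_ball x0 r)))
       - l *\<^sub>R fourier_L2 (abs_L2 (normalized_ball x0 r))) \<le> \<epsilon> * ?c"
    by (rule normalized_ball_approx_eigenvector[OF assms(5) r0(1) \<epsilon>c])
  let ?g = "abs_L2 (normalized_ball x0 r)"
  have disj: "normalized_ball x0 r x = 0" if "x \<in> \<omega>" for x
  proof (rule normalized_ball_eq_0)
    have "x \<notin> ball x0 r0" using that r0(2) closure_subset[of \<omega>] by blast
    then show "x \<notin> ball x0 r" using subset_ball[OF r(2), of x0] by blast
  qed
  have approx: "?g \<bullet> (- (multiplier F u + mult_indicator \<omega> (K u)) + l *\<^sub>R u) \<ge> - \<epsilon> * norm u" for u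
  proof -
    have "?g \<bullet> mult_indicator \<omega> (K u) = 0"
      by (rule inner_mult_indicator_eq_0[OF normalized_ball(1)[OF r(1)] assms(3) disj])
    then have "?g \<bullet> (- (multiplier F u + mult_indicator \<omega> (K u)) + l *\<^sub>R u)
        = - (?g \<bullet> (multiplier F u - l *\<^sub>R u))"
      by (simp add: inner_diff_right inner_add_right)
    moreover have "\<bar>?g \<bullet> (multiplier F u - l *\<^sub>R u)\<bar> \<le> \<epsilon> * norm u"
    proof (rule order_trans[OF inner_multiplier_minus mult_right_mono])
      show "norm (symbol_mult F (fourier_L2 ?g) - l *\<^sub>R fourier_L2 ?g) / ?c \<le> \<epsilon>"
        using r(3) by (simp add: pos_divide_le_eq)
    qed simp
    ultimately show ?thesis by linarith
  qed
  have "norm ?g \<le> \<epsilon> * M / (\<alpha> - l)"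
    by (rule semigroup_decay_excludes_approx_eigenvector[OF sg gen[unfolded multiplier_dom_eq_UNIV] decay \<alpha>(2,1) _ approx])
       (use M \<epsilon> in auto)
  also have "\<dots> = 1 / 2"
    using \<alpha> M by (simp add: \<epsilon>_def)
  finally show False
    by (simp add: normalized_ball(2)[OF r(1)])
qed

end
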